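(* There exists an absolute constant $C>0$ such that the following holds. Let $k\in\mathbb{Z}_{\geq2}$ and let $m_1,\dots,m_k\in\mathbb{Z}_{\geq0}$ with $m_1\geq m_2\geq\cdots\geq m_k$. For $i=1,\ldots,k$ let $f_i$ be an eigenfunction of the Laplace--Beltrami operator $\Delta_{\mathbb{S}^3}$ on the standard three-sphere $\mathbb{S}^3$ such that $\Delta_{\mathbb{S}^3}f_i=-m_i(m_i+2)f_i$. Then $$\left\|\prod_{i=1}^kf_i\right\|_{L^2(\mathbb{S}^3)}\leq C\left((m_2+1)^{\frac12}\prod_{i=3}^k(m_i+1)\right)\prod_{i=1}^k\|f_i\|_{L^2(\mathbb{S}^3)}.$$
   Context: $\mathbb{S}^3$ carries its standard round metric and standard rotation-invariant measure (for example normalized to be a probability measure). For $k=2$ the product $\prod_{i=3}^k$ is empty and equals $1$. *)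

theory Defs
  imports "HOL-Analysis.Analysis"
begin

section \<open>The Laplace--Beltrami operator of the unit sphere\<close>

text \<open>
  The unit sphere of a Euclidean space carries the metric induced by the ambient inner product.
  A function on the sphere is a function on the ambient space of which only the values on
  \<^term>\<open>sphere 0 1\<close> matter. A derivative \<^term>\<open>at p within sphere 0 1\<close> is determined only on the
  tangent space at \<open>p\<close>, that is, on the orthogonal complement of \<open>p\<close>; hence every
  Frechet derivative below is composed with the orthogonal projection onto that space.
\<close>

definition tangent_proj :: "'a::euclidean_space \<Rightarrow> 'a \<Rightarrow> 'a" where
  "tangent_proj p h = h - (h \<bullet> p) *\<^sub>R p"

definition sphere_grad :: "('a::euclidean_space \<Rightarrow> real) \<Rightarrow> 'a \<Rightarrow> 'a" where
  "sphere_grad u p =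
     (\<Sum>b\<in>Basis. frechet_derivative u (at p within sphere 0 1) (tangent_proj p b) *\<^sub>R b)"

text \<open>
  The Levi-Civita connection of the sphere is the tangential part of the ambient derivative, and
  the divergence of a tangent field is the trace of its covariant derivative.
\<close>

definition sphere_cov_deriv :: "('a::euclidean_space \<Rightarrow> 'a) \<Rightarrow> 'a \<Rightarrow> 'a \<Rightarrow> 'a" where
  "sphere_cov_deriv X p v =
     tangent_proj p (frechet_derivative X (at p within sphere 0 1) (tangent_proj p v))"

definition sphere_div :: "('a::euclidean_space \<Rightarrow> 'a) \<Rightarrow> 'a \<Rightarrow> real" where
  "sphere_div X p = (\<Sum>b\<in>Basis. sphere_cov_deriv X p b \<bullet> b)"

definition sphere_laplacian_real :: "('a::euclidean_space \<Rightarrow> real) \<Rightarrow> 'a \<Rightarrow> real" where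
  "sphere_laplacian_real u = sphere_div (sphere_grad u)"

definition sphere_laplacian :: "('a::euclidean_space \<Rightarrow> complex) \<Rightarrow> 'a \<Rightarrow> complex" where
  "sphere_laplacian f p =
     Complex (sphere_laplacian_real (\<lambda>x. Re (f x)) p) (sphere_laplacian_real (\<lambda>x. Im (f x)) p)"

definition sphere_C2_real :: "('a::euclidean_space \<Rightarrow> real) \<Rightarrow> bool" where
  "sphere_C2_real u \<longleftrightarrow>
     u differentiable_on sphere 0 1 \<and>
     (\<exists>D :: 'a \<Rightarrow> ('a \<Rightarrow>\<^sub>L 'a). continuous_on (sphere 0 1) D \<and>
        (\<forall>p\<in>sphere 0 1. (sphere_grad u has_derivative blinfun_apply (D p)) (at p within sphere 0 1)))"

definition sphere_C2 :: "('a::euclidean_space \<Rightarrow> complex) \<Rightarrow> bool" where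
  "sphere_C2 f \<longleftrightarrow> sphere_C2_real (\<lambda>x. Re (f x)) \<and> sphere_C2_real (\<lambda>x. Im (f x))"

text \<open>
  Classical eigenfunctions: not identically zero and twice continuously differentiable
  (hence smooth, by elliptic regularity).
\<close>

definition sphere_eigenfunction :: "real \<Rightarrow> ('a::euclidean_space \<Rightarrow> complex) \<Rightarrow> bool" where
  "sphere_eigenfunction \<mu> f \<longleftrightarrow>
     sphere_C2 f \<and> (\<exists>p\<in>sphere 0 1. f p \<noteq> 0) \<and>
     (\<forall>p\<in>sphere 0 1. sphere_laplacian f p = of_real \<mu> * f p)"

lemma tangent_proj_orth: "norm p = 1 \<Longrightarrow> tangent_proj p h \<bullet> p = 0"
  by (simp add: tangent_proj_def inner_diff_left dot_square_norm)

lemma has_derivative_sphere_unique: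
  fixes f :: "'a::euclidean_space \<Rightarrow> 'b::real_normed_vector"
  assumes p: "norm p = 1" and v: "v \<bullet> p = 0"
    and D: "(f has_derivative D) (at p within sphere 0 1)"
    and D': "(f has_derivative D') (at p within sphere 0 1)"
  shows "D v = D' v"
proof (cases "v = 0")
  case True
  then show ?thesis
    using D D' by (simp add: has_derivative_bounded_linear linear_simps(3))
next
  case False
  define e where "e = sgn v"
  have e: "norm e = 1" "e \<bullet> p = 0" "v = norm v *\<^sub>R e"
    using False v by (auto simp: e_def norm_sgn sgn_div_norm)
  define c where "c = (\<lambda>t. cos t *\<^sub>R p + sin t *\<^sub>R e)"
  have n: "norm (c t) = 1" for t
  proof -
    have "(norm (c t))\<^sup>2 = (cos t)\<^sup>2 + (sin t)\<^sup>2"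
      unfolding c_def power2_norm_eq_inner using e p inner_commute[of e p]
      by (simp add: norm_eq_1 inner_add_left inner_add_right power2_eq_square)
    then show ?thesis by (simp add: abs_square_eq_1)
  qed
  have c: "(c has_derivative (\<lambda>t. t *\<^sub>R e)) (at 0)"
    unfolding c_def by (auto intro!: derivative_eq_intros)
  have c0: "c 0 = p" by (simp add: c_def)
  have sub: "range c \<subseteq> sphere 0 1" using n by auto
  have *: "(f \<circ> c has_derivative F \<circ> (\<lambda>t. t *\<^sub>R e)) (at 0)"
    if "(f has_derivative F) (at p within sphere 0 1)" for F
    using diff_chain_within[OF c, of f F] has_derivative_subset[OF that sub] c0 by auto
  have "D \<circ> (\<lambda>t. t *\<^sub>R e) = D' \<circ> (\<lambda>t. t *\<^sub>R e)"
    using has_derivative_unique[OF *[OF D] *[OF D']] .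
  then show ?thesis using e(3) by (metis comp_apply)
qed

lemma sphere_grad_eq:
  assumes p: "norm p = 1" and D: "(u has_derivative D) (at p within sphere 0 1)"
  shows "sphere_grad u p = (\<Sum>b\<in>Basis. D (tangent_proj p b) *\<^sub>R b)"
  unfolding sphere_grad_def
  by (intro sum.cong refl arg_cong2[where f=scaleR] has_derivative_sphere_unique[OF p tangent_proj_orth[OF p] _ D])
     (use D in \<open>metis differentiable_def frechet_derivative_works\<close>)

lemma sphere_div_eq:
  assumes p: "norm p = 1" and D: "(X has_derivative D) (at p within sphere 0 1)"
  shows "sphere_div X p = (\<Sum>b\<in>Basis. tangent_proj p (D (tangent_proj p b)) \<bullet> b)"
  unfolding sphere_div_def sphere_cov_deriv_def
  by (intro sum.cong refl arg_cong2[where f=inner] arg_cong[where f="tangent_proj p"] has_derivative_sphere_unique[OF p tangent_proj_orth[OF p] _ D])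
     (use D in \<open>metis differentiable_def frechet_derivative_works\<close>)

lemma sphere_grad_inner:
  assumes p: "norm p = 1" shows "sphere_grad (\<lambda>x. a \<bullet> x) p = tangent_proj p a"
proof -
  have "((\<lambda>x. a \<bullet> x) has_derivative (\<lambda>x. a \<bullet> x)) (at p within sphere 0 1)"
    by (auto intro!: derivative_eq_intros)
  from sphere_grad_eq[OF p this] have "sphere_grad (\<lambda>x. a \<bullet> x) p = (\<Sum>b\<in>Basis. (tangent_proj p a \<bullet> b) *\<^sub>R b)"
    by (simp add: tangent_proj_def inner_diff_left inner_diff_right inner_commute mult.commute)
  then show ?thesis by (simp add: euclidean_representation)
qed

lemma sphere_laplacian_real_inner:
  assumes p: "norm p = 1" shows "sphere_laplacian_real (\<lambda>x. a \<bullet> x) p = - (real DIM('a) - 1) * (a \<bullet> (p::'a::euclidean_space))"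
proof -
  let ?D = "\<lambda>h. - ((a \<bullet> h) *\<^sub>R p + (a \<bullet> p) *\<^sub>R h)"
  have "((\<lambda>p. tangent_proj p a) has_derivative ?D) (at p within sphere 0 1)"
    unfolding tangent_proj_def by (auto intro!: derivative_eq_intros)
  then have 1: "(sphere_grad (\<lambda>x. a \<bullet> x) has_derivative ?D) (at p within sphere 0 1)"
    by (rule has_derivative_transform[rotated 2]) (use p sphere_grad_inner in auto)
  have pp: "p \<bullet> p = 1" using p by (simp add: norm_eq_1)
  have "tangent_proj p (?D (tangent_proj p b)) \<bullet> b = - (a \<bullet> p) * (1 - (b \<bullet> p) * (p \<bullet> b))" if "b \<in> Basis" for b
    using that pp by (simp add: tangent_proj_def algebra_simps inner_commute)
  then have "sphere_laplacian_real (\<lambda>x. a \<bullet> x) p = (\<Sum>b\<in>Basis. - (a \<bullet> p) * (1 - (b \<bullet> p) * (p \<bullet> b)))"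
    unfolding sphere_laplacian_real_def sphere_div_eq[OF p 1] by (intro sum.cong) auto
  also have "\<dots> = - (a \<bullet> p) * (DIM('a) - (\<Sum>b\<in>Basis. (p \<bullet> b) * (p \<bullet> b)))"
    by (simp only: sum_distrib_left[symmetric] sum_subtractf) (simp add: inner_commute)
  also have "\<dots> = - (a \<bullet> p) * (DIM('a) - 1)"
    using pp euclidean_inner[of p p] by simp
  finally show ?thesis by (simp add: algebra_simps)
qed


section \<open>The rotation-invariant probability measure on the sphere\<close>

text \<open>
  The image of the uniform distribution on the unit ball under radial projection, as a measure
  with underlying space \<^term>\<open>sphere 0 1\<close>. The origin, where \<^term>\<open>sgn\<close> does not project to the
  sphere, is a null set.
\<close>

definition sphere_measure :: "'a::euclidean_space measure" where
  "sphere_measure =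
     restrict_space (distr (uniform_measure lborel (ball 0 1)) borel sgn) (sphere 0 1)"

definition sphere_L2_norm :: "('a::euclidean_space \<Rightarrow> complex) \<Rightarrow> real" where
  "sphere_L2_norm f = sqrt (\<integral>x. (cmod (f x))\<^sup>2 \<partial>sphere_measure)"

lemma borel_measurable_sgn_euclidean [measurable]: "(sgn :: 'a::euclidean_space \<Rightarrow> 'a) \<in> borel_measurable borel"
  unfolding sgn_div_norm by measurable

lemma sets_sphere_measure_iff: "A \<in> sets (sphere_measure :: 'a::euclidean_space measure) \<longleftrightarrow> A \<in> sets borel \<and> A \<subseteq> sphere 0 1"
  unfolding sphere_measure_def by (subst sets_restrict_space_iff) (auto)

lemma emeasure_sphere_measure:
  assumes "A \<in> sets (sphere_measure :: 'a::euclidean_space measure)"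
  shows "emeasure sphere_measure A = emeasure lborel (ball 0 1 \<inter> sgn -` A) / emeasure lborel (ball (0::'a) 1)"
proof -
  have A: "A \<in> sets borel" "A \<subseteq> sphere 0 1" using assms by (auto simp: sets_sphere_measure_iff)
  have [simp]: "sgn -` A \<in> sets lborel" using measurable_sets_borel[OF borel_measurable_sgn_euclidean A(1)] by simp
  have "emeasure sphere_measure A = emeasure (distr (uniform_measure lborel (ball 0 1)) borel sgn) A"
    unfolding sphere_measure_def by (rule emeasure_restrict_space) (use A in auto)
  also have "\<dots> = emeasure (uniform_measure lborel (ball (0::'a) 1)) (sgn -` A)"
    by (subst emeasure_distr) (use A in \<open>auto simp: measurable_def measurable_sets_borel[OF borel_measurable_sgn_euclidean]\<close>)
  also have "\<dots> = emeasure lborel (ball 0 1 \<inter> sgn -` A) / emeasure lborel (ball (0::'a) 1)"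
    by (rule emeasure_uniform_measure) (simp_all add: measurable_sets_borel[OF borel_measurable_sgn_euclidean A(1)])
  finally show ?thesis .
qed

lemma emeasure_sphere_measure_space: "emeasure (sphere_measure :: 'a::euclidean_space measure) (sphere 0 1) = 1"
proof -
  have "ball 0 1 \<inter> sgn -` sphere (0::'a) 1 = ball 0 1 - {0}"
    by (auto simp: norm_sgn)
  moreover have "emeasure lborel (ball (0::'a) 1 - {0}) = emeasure lborel (ball (0::'a) 1)"
    by (subst emeasure_Diff) auto
  moreover have "emeasure lborel (ball (0::'a) 1) \<noteq> 0"
    using open_ball[of "0::'a" 1] centre_in_ball[of "0::'a" 1]
    by (metis Diff_empty empty_iff interior_open negligible_iff_null_sets null_sets_completionI null_setsI open_not_negligible sets_lborel borel_open zero_less_one)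
  moreover have "emeasure lborel (ball (0::'a) 1) \<noteq> \<infinity>"
    using emeasure_lborel_ball_finite[of "0::'a" 1] by auto
  moreover have "sphere (0::'a) 1 \<in> sets sphere_measure"
    by (simp add: sets_sphere_measure_iff)
  ultimately show ?thesis
    using ennreal_divide_self[of "emeasure lborel (ball (0::'a) 1)"]
    by (simp only: emeasure_sphere_measure) (simp add: top.not_eq_extremum)
qed

lemma emeasure_sphere_measure_rotation:
  fixes T :: "real^4 \<Rightarrow> real^4"
  assumes T: "orthogonal_transformation T" and A: "A \<in> sets sphere_measure"
  shows "emeasure sphere_measure (T ` A) = emeasure sphere_measure A"
proof -
  have Ab: "A \<in> sets borel" "A \<subseteq> sphere 0 1" using A by (auto simp: sets_sphere_measure_iff)
  have inv: "orthogonal_transformation (inv T)" by (simp add: T orthogonal_transformation_inv)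
  have bij: "bij T" by (simp add: T orthogonal_transformation_bij)
  have "T ` A = inv T -` A" using bij by (simp add: bij_vimage_eq_inv_image inv_inv_eq bij_imp_bij_inv)
  moreover have "inv T \<in> borel_measurable borel"
    using linear_continuous_on[of "inv T" UNIV] orthogonal_transformation_linear[OF inv] by (intro borel_measurable_continuous_onI) (simp add: linear_conv_bounded_linear)
  ultimately have TA: "T ` A \<in> sets borel"
    using measurable_sets_borel[of "inv T" borel A] Ab by simp
  have TA': "T ` A \<in> sets sphere_measure"
    using TA Ab(2) T by (auto simp: sets_sphere_measure_iff orthogonal_transformation_norm)
  have sT: "sgn (T x) = T (sgn x)" for x
    using T by (simp add: sgn_div_norm orthogonal_transformation_norm linear_scale orthogonal_transformation_linear)
  have eq: "ball 0 1 \<inter> sgn -` (T ` A) = T ` (ball 0 1 \<inter> sgn -` A)"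
  proof (intro equalityI subsetI)
    fix x assume x: "x \<in> ball 0 1 \<inter> sgn -` (T ` A)"
    obtain y where y: "x = T y" using bij by (metis bij_pointE)
    with x have "T (sgn y) \<in> T ` A" "norm y < 1" using T by (auto simp: sT orthogonal_transformation_norm)
    then have "sgn y \<in> A" using bij by (simp add: bij_is_inj inj_image_mem_iff)
    then show "x \<in> T ` (ball 0 1 \<inter> sgn -` A)" using y \<open>norm y < 1\<close> by auto
  qed (use T in \<open>auto simp: sT orthogonal_transformation_norm\<close>)
  let ?B = "ball 0 1 \<inter> sgn -` A"
  have Bb: "?B \<in> sets borel" using measurable_sets_borel[OF borel_measurable_sgn_euclidean Ab(1)] by (intro sets.Int) auto
  have Bl: "?B \<in> lmeasurable"
    by (rule bounded_set_imp_lmeasurable) (use Bb in \<open>auto intro: bounded_subset[OF bounded_ball]\<close>)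
  have TBb: "T ` ?B \<in> sets borel" using eq TA measurable_sets_borel[OF borel_measurable_sgn_euclidean] by (metis borel_open open_ball sets.Int)
  have m: "measure lebesgue (T ` ?B) = measure lebesgue ?B" by (rule measure_orthogonal_image[OF T Bl])
  have TBl: "T ` ?B \<in> lmeasurable"
    by (rule bounded_set_imp_lmeasurable) (use TBb in \<open>auto intro!: bounded_subset[OF bounded_ball[of 0 1]] simp: T orthogonal_transformation_norm\<close>)
  have "emeasure lborel (T ` ?B) = emeasure lborel ?B"
    using m Bb TBb emeasure_eq_measure2[OF Bl] emeasure_eq_measure2[OF TBl] by simp
  then show ?thesis using A TA' by (simp add: emeasure_sphere_measure eq)
qed

end

theory Submission
  imports Defs "HOL-Computational_Algebra.Polynomial"
begin

text \<open>
  Write \<open>U\<^sub>m\<close> for the Chebyshev polynomials of the second kind and \<open>\<sigma>\<close> for the invariant probability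
  measure. An eigenfunction \<open>u\<close> of degree \<open>m\<close> is reproduced by the zonal kernel,
  \<open>u x = (m + 1) \<integral> U\<^sub>m(x \<bullet> y) u y d\<sigma>(y)\<close>, and \<open>U\<^sub>m(x \<bullet> _)\<close> has \<open>L\<^sup>2\<close> norm 1; hence
  \<open>sup |u| \<le> (m + 1) \<parallel>u\<parallel>\<close>. This pays for every factor from the third on, and it remains to bound the
  product of two eigenfunctions of degrees \<open>m \<ge> n\<close> by \<open>C (n + 1)\<^sup>1\<^sup>/\<^sup>2\<close>. Splitting into real and
  imaginary parts, both may be taken real.

  Let \<open>u\<close>, \<open>w\<close> be real of degrees \<open>m \<ge> n\<close>, put \<open>F = u w\<close>, \<open>h = - \<Delta> F\<close> and \<open>\<lambda>\<^sub>j = j (j + 2)\<close>. The Dirichlet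
  integral \<open>D = \<integral> F h\<close> is compared with \<open>\<integral> F\<^sup>2\<close> from two sides.

  Lower bound (\<open>product_energy\<close>). The pointwise identity
  \<open>F h = \<lambda>\<^sub>m F\<^sup>2 + u\<^sup>2 |grad w|\<^sup>2 - div (u\<^sup>2 w grad w)\<close> integrates to \<open>\<lambda>\<^sub>m \<integral> F\<^sup>2 \<le> D\<close>. So \<open>F\<close> lives on average
  at frequency at least \<open>m\<close>, although it may contain low frequencies when \<open>n\<close> is close to \<open>m\<close>.

  Upper bound (\<open>product_duality\<close>, \<open>product_dirichlet_bound\<close>). Reproducing both factors and applying
  Cauchy--Schwarz on the product of two spheres gives, for every continuous \<open>g\<close>,
  \<open>(\<integral> F g)\<^sup>2 \<le> (m + 1) (n + 1) \<parallel>u\<parallel>\<^sup>2 \<parallel>w\<parallel>\<^sup>2 \<integral>\<integral> g x U\<^sub>m(x \<bullet> z) U\<^sub>n(x \<bullet> z) g z\<close>.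
  The Clebsch--Gordan rule \<open>U\<^sub>m U\<^sub>n = \<Sum> U\<^sub>j\<close>, with \<open>j = m - n, m - n + 2, \<dots>, m + n\<close>, turns the double
  integral into the sum of \<open>\<parallel>P\<^sub>j g\<parallel>\<^sup>2 / (j + 1)\<close>, where \<open>P\<^sub>j\<close> is the projection onto degree \<open>j\<close>. Taking
  zonal \<open>g\<close> of other degrees shows that \<open>F\<close> has no components outside this range. Taking \<open>g = h\<close>, and
  using \<open>P\<^sub>j h = \<lambda>\<^sub>j P\<^sub>j F\<close> and \<open>\<lambda>\<^sub>j / (j + 1) \<le> m + n + 1\<close>, the double integral is at most \<open>(m + n + 1) D\<close>.
  Therefore \<open>D \<le> (m + 1) (n + 1) (m + n + 1) \<parallel>u\<parallel>\<^sup>2 \<parallel>w\<parallel>\<^sup>2\<close>.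

  Together, \<open>\<integral> F\<^sup>2 \<le> 2 (n + 1) \<parallel>u\<parallel>\<^sup>2 \<parallel>w\<parallel>\<^sup>2\<close> for \<open>m \<ge> 1\<close>, and \<open>m = 0\<close> is the case of constants.

  Integration by parts on the sphere rests on the quaternions: left multiplication by the three
  imaginary units yields at every point an orthonormal tangent frame whose flows are rotations.
  The Laplacian is the sum of the squares of these three fields, and the integral of any derivative
  along them vanishes since \<open>\<sigma>\<close> is rotation invariant.
\<close>

section \<open>The quaternionic frame\<close>

lemma vector_4:
  fixes a b c d :: "'a::zero"
  shows "(vector [a, b, c, d] :: 'a^4) $ 1 = a" "(vector [a, b, c, d] :: 'a^4) $ 2 = b"
    "(vector [a, b, c, d] :: 'a^4) $ 3 = c" "(vector [a, b, c, d] :: 'a^4) $ 4 = d"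
  unfolding vector_def by simp_all

text \<open>
  With \<open>real^4\<close> read as the quaternions in the basis \<open>1, i, j, k\<close>, the indices 0, 1, 2 stand for left
  multiplication by \<open>i\<close>, \<open>j\<close>, \<open>k\<close>; larger indices repeat the last one.
\<close>

definition quat_unit :: "nat \<Rightarrow> real^4 \<Rightarrow> real^4" where
  "quat_unit i p =
     (if i = 0 then vector [- p$2, p$1, - p$4, p$3]
      else if i = 1 then vector [- p$3, p$4, p$1, - p$2]
      else vector [- p$4, - p$3, p$2, p$1])"

text \<open>
  Left multiplication by \<open>exp (t i)\<close>, \<open>exp (t j)\<close> or \<open>exp (t k)\<close>: a one-parameter group of rotations whose
  orbits on the sphere are unit-speed great circles.
\<close>

definition rot :: "nat \<Rightarrow> real \<Rightarrow> real^4 \<Rightarrow> real^4" where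
  "rot i t p = cos t *\<^sub>R p + sin t *\<^sub>R quat_unit i p"

lemmas quat_component_simps = quat_unit_def vec_eq_iff forall_4 inner_vec_def sum_4 vector_4

lemma quat_unit_linear: "linear (quat_unit i)"
  by (rule linearI) (simp_all add: quat_component_simps algebra_simps)

lemma quat_unit_square [simp]: "quat_unit i (quat_unit i p) = - p"
  by (simp add: quat_component_simps)

lemma quat_unit_orth_self [simp]: "p \<bullet> quat_unit i p = 0" "quat_unit i p \<bullet> p = 0"
  by (simp_all add: quat_component_simps algebra_simps)

lemma quat_unit_inner [simp]: "quat_unit i p \<bullet> quat_unit i q = p \<bullet> q"
  by (simp add: quat_component_simps algebra_simps)

text \<open>
  The three vectors \<open>quat_unit i p\<close> are an orthonormal basis of the tangent space at \<open>p\<close>. In coordinates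
  this is a polynomial identity once the right side is homogenised by \<open>norm p = 1\<close>.
\<close>

lemma tangent_proj_quat_frame:
  assumes "norm p = 1"
  shows "tangent_proj p h = (\<Sum>i<3. (h \<bullet> quat_unit i p) *\<^sub>R quat_unit i p)"
proof -
  have pp: "p$1*p$1 + p$2*p$2 + p$3*p$3 + p$4*p$4 = 1"
    using assms by (simp add: norm_eq_1 inner_vec_def sum_4)
  have *: "tangent_proj p h = (p$1*p$1 + p$2*p$2 + p$3*p$3 + p$4*p$4) *\<^sub>R h - (h \<bullet> p) *\<^sub>R p"
    by (simp add: pp tangent_proj_def)
  show ?thesis unfolding *
    by (simp add: quat_component_simps numeral_3_eq_3 lessThan_Suc algebra_simps)
qed

lemma quat_unit_parseval:
  assumes "norm p = 1"
  shows "(\<Sum>i<3. (x \<bullet> quat_unit i p)\<^sup>2) = x \<bullet> x - (x \<bullet> p)\<^sup>2"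
proof -
  have "(\<Sum>i<3. (x \<bullet> quat_unit i p)\<^sup>2) = tangent_proj p x \<bullet> x"
    unfolding tangent_proj_quat_frame[OF assms] 
    by (simp add: inner_sum_right power2_eq_square inner_commute)
  then show ?thesis by (simp add: tangent_proj_def inner_diff_left inner_diff_right power2_eq_square inner_commute)
qed

lemma rot_0 [simp]: "rot i 0 p = p"
  by (simp add: rot_def)

lemma rot_add: "rot i t (rot i s p) = rot i (t + s) p"
  by (simp add: rot_def linear_add[OF quat_unit_linear] linear_scale[OF quat_unit_linear] cos_add sin_add algebra_simps)

lemma rot_orthogonal: "orthogonal_transformation (rot i t)"
proof -
  have "linear (rot i t)"
    by (rule linearI) (simp_all add: rot_def linear_add[OF quat_unit_linear] linear_scale[OF quat_unit_linear] algebra_simps)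
  moreover have "rot i t v \<bullet> rot i t w = v \<bullet> w" for v w
  proof -
    have "quat_unit i v \<bullet> w = - (v \<bullet> quat_unit i w)"
      by (simp add: quat_component_simps algebra_simps)
    then have "rot i t v \<bullet> rot i t w = (cos t * cos t + sin t * sin t) * (v \<bullet> w)"
      by (simp add: rot_def inner_add_left inner_add_right algebra_simps del: sin_cos_squared_add3)
    then show ?thesis by simp
  qed
  ultimately show ?thesis by (simp add: orthogonal_transformation_def)
qed

lemma norm_rot [simp]: "norm (rot i t p) = norm p"
  using orthogonal_transformation_norm[OF rot_orthogonal] .

lemma rot_has_derivative: "((\<lambda>t. rot i t p) has_derivative (\<lambda>t. t *\<^sub>R quat_unit i p)) (at 0)"
  unfolding rot_def by (auto intro!: derivative_eq_intros)

lemma continuous_quat_unit: "continuous_on A (quat_unit i)"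
  using quat_unit_linear by (simp add: linear_continuous_on linear_linear)

section \<open>Integration over the three-sphere\<close>

abbreviation \<sigma> :: "(real^4) measure" where "\<sigma> \<equiv> sphere_measure"

abbreviation \<S> :: "(real^4) set" where "\<S> \<equiv> sphere 0 1"

lemma space_\<sigma> [simp]: "space \<sigma> = \<S>"
  by (simp add: sphere_measure_def space_restrict_space)

lemma sets_\<sigma>: "sets \<sigma> = sets (restrict_space borel \<S>)"
  unfolding sphere_measure_def by (rule sets_restrict_space_cong) simp

interpretation sphere_measure: finite_measure \<sigma>
  by standard (simp add: emeasure_sphere_measure_space)

interpretation sphere_pair: pair_sigma_finite \<sigma> \<sigma> ..

lemma measure_\<sigma>_space [simp]: "measure \<sigma> \<S> = 1"
  by (simp add: measure_def emeasure_sphere_measure_space)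

lemma borel_measurable_continuous_sphere:
  "continuous_on \<S> f \<Longrightarrow> f \<in> borel_measurable \<sigma>" for f :: "real^4 \<Rightarrow> 'b::topological_space"
  using borel_measurable_continuous_on_restrict[of \<S> f] measurable_cong_sets[OF sets_\<sigma> refl] by auto

lemma bounded_continuous_sphere:
  fixes f :: "real^4 \<Rightarrow> real"
  assumes "continuous_on \<S> f"
  obtains B where "\<And>x. x \<in> \<S> \<Longrightarrow> \<bar>f x\<bar> \<le> B"
  using compact_imp_bounded[OF compact_continuous_image[OF assms compact_sphere]]
  unfolding bounded_iff by (metis imageI real_norm_def)

lemma integrable_continuous_sphere:
  fixes f :: "real^4 \<Rightarrow> real"
  assumes "continuous_on \<S> f"
  shows "integrable \<sigma> f"
proof -
  obtain B where "\<And>x. x \<in> \<S> \<Longrightarrow> \<bar>f x\<bar> \<le> B"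
    using bounded_continuous_sphere[OF assms] by blast
  then show ?thesis
    by (intro sphere_measure.integrable_const_bound[where B = B] borel_measurable_continuous_sphere assms) auto
qed

lemma continuous_rot: "continuous_on A (rot i t)"
  using rot_orthogonal[THEN orthogonal_transformation_linear]
  by (simp add: linear_continuous_on linear_linear)

lemma rot_measurable [measurable]: "rot i t \<in> measurable \<sigma> \<sigma>"
proof -
  have "rot i t \<in> measurable \<sigma> (restrict_space borel \<S>)"
    by (rule measurable_restrict_space2) (use continuous_rot in \<open>auto intro: borel_measurable_continuous_sphere\<close>)
  then show ?thesis using measurable_cong_sets[OF refl sets_\<sigma>] by blast
qed

text \<open>
  Invariance of \<open>\<sigma>\<close> under these rotations is the only property of the measure from which the integration
  by parts below is derived.
\<close>

lemma distr_rot: "distr \<sigma> \<sigma> (rot i t) = \<sigma>"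
proof (rule measure_eqI)
  fix A assume "A \<in> sets (distr \<sigma> \<sigma> (rot i t))"
  then have A: "A \<in> sets \<sigma>" by simp
  then have sub: "A \<subseteq> \<S>" by (simp add: sets_sphere_measure_iff)
  have inverse: "rot i t (rot i (-t) p) = p" "rot i (-t) (rot i t p) = p" for p
    by (simp_all add: rot_add)
  have "rot i t -` A \<inter> \<S> = rot i (-t) ` A"
  proof (intro equalityI subsetI)
    fix p assume "p \<in> rot i t -` A \<inter> \<S>"
    then show "p \<in> rot i (-t) ` A" by (intro image_eqI[of _ _ "rot i t p"]) (auto simp: inverse)
  next
    fix p assume "p \<in> rot i (-t) ` A"
    then show "p \<in> rot i t -` A \<inter> \<S>" using sub by (auto simp: inverse subset_iff)
  qed
  then show "emeasure (distr \<sigma> \<sigma> (rot i t)) A = emeasure \<sigma> A"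
    using A emeasure_sphere_measure_rotation[OF rot_orthogonal A] by (simp add: emeasure_distr)
qed simp

lemma integral_rot:
  fixes f :: "real^4 \<Rightarrow> real"
  assumes "continuous_on \<S> f"
  shows "(\<integral>p. f (rot i t p) \<partial>\<sigma>) = (\<integral>p. f p \<partial>\<sigma>)"
  using integral_distr[of "rot i t" \<sigma> \<sigma> f] distr_rot borel_measurable_continuous_sphere[OF assms]
  by auto

text \<open>
  Nonempty relatively open subsets of the sphere have positive measure, because the cone over them
  contains an open set of the ball.
\<close>

lemma nonneg_integral_zero_imp_zero:
  fixes g :: "real^4 \<Rightarrow> real"
  assumes g: "continuous_on \<S> g" "\<And>y. y \<in> \<S> \<Longrightarrow> 0 \<le> g y"
    and zero: "(\<integral>y. g y \<partial>\<sigma>) = 0" and x: "x \<in> \<S>"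
  shows "g x = 0"
proof (rule ccontr)
  assume "g x \<noteq> 0"
  with g x have pos: "g x \<in> {0<..}" by force
  obtain A where A: "open A" "A \<inter> \<S> = g -` {0<..} \<inter> \<S>"
    using g(1) unfolding continuous_on_open_invariant by (meson open_greaterThan)
  have "AE y in \<sigma>. 0 \<le> g y" using g(2) by (intro AE_I2) simp
  then have "AE y in \<sigma>. g y = 0"
    using integral_nonneg_eq_0_iff_AE[OF integrable_continuous_sphere[OF g(1)]] zero by blast
  then have "AE y in \<sigma>. y \<notin> A \<inter> \<S>"
    by eventually_elim (use A in auto)
  moreover have sets: "A \<inter> \<S> \<in> sets \<sigma>"
    unfolding sets_sphere_measure_iff using A(1) by (intro conjI sets.Int) auto
  ultimately have "emeasure \<sigma> (A \<inter> \<S>) = 0"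
    using AE_iff_null_sets[OF sets] null_setsD1 by blast
  then have null: "emeasure lborel (ball 0 1 \<inter> sgn -` (A \<inter> \<S>)) = 0"
    using emeasure_sphere_measure[OF sets] emeasure_lborel_ball_finite[of "0::real^4" 1]
    by (auto simp: ennreal_divide_eq_0_iff)
  define U where "U = ball 0 1 \<inter> (sgn -` A \<inter> - {0})"
  have "continuous_on (- {0::real^4}) sgn"
    unfolding sgn_div_norm by (intro continuous_intros) auto
  then have "open (sgn -` A \<inter> - {0::real^4})"
    using A continuous_on_open_vimage[of "- {0::real^4}" sgn] by auto
  then have "open U" unfolding U_def by auto
  moreover have "(1/2) *\<^sub>R x \<in> U"
  proof -
    have "x \<in> A" using x pos A(2) by blast
    moreover have "sgn ((1/2) *\<^sub>R x) = x" using x by (simp add: sgn_div_norm)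
    ultimately show ?thesis using x by (auto simp: U_def)
  qed
  moreover have "U \<subseteq> ball 0 1 \<inter> sgn -` (A \<inter> \<S>)"
    by (auto simp: U_def norm_sgn)
  moreover have "ball 0 1 \<inter> sgn -` (A \<inter> \<S>) \<in> null_sets lborel"
    using null sets measurable_sets_borel[OF borel_measurable_sgn_euclidean, of "A \<inter> \<S>"]
    by (auto simp: null_sets_def sets_sphere_measure_iff)
  ultimately have "U \<in> null_sets (completion lborel)"
    by (meson null_sets_completionI null_sets_completion_subset)
  with \<open>open U\<close> \<open>(1/2) *\<^sub>R x \<in> U\<close> show False
    using open_not_negligible[of U] negligible_iff_null_sets by blast
qed

section \<open>Derivatives along the frame\<close>

definition field_deriv :: "nat \<Rightarrow> (real^4 \<Rightarrow> real) \<Rightarrow> (real^4 \<Rightarrow> real) \<Rightarrow> bool" where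
  "field_deriv i v w \<longleftrightarrow> (\<forall>p\<in>\<S>. ((\<lambda>t. v (rot i t p)) has_real_derivative w p) (at 0))"

text \<open>
  By the group law, differentiability at time 0 from every point gives differentiability along whole
  orbits.
\<close>

lemma field_deriv_flow:
  assumes "field_deriv i v w" "p \<in> \<S>"
  shows "((\<lambda>t. v (rot i t p)) has_real_derivative w (rot i s p)) (at s)"
proof -
  have "((\<lambda>t. v (rot i t (rot i s p))) has_real_derivative w (rot i s p)) (at 0)"
    using assms by (auto simp: field_deriv_def)
  then show ?thesis
    using DERIV_shift[of "\<lambda>t. v (rot i t p)" "w (rot i s p)" 0 s] by (simp add: rot_add)
qed

text \<open>
  The integral of \<open>v\<close> composed with a rotation is independent of the angle, so its derivative, which is the
  integral of the derivative of \<open>v\<close>, vanishes. The mean value theorem along orbits dominates the difference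
  quotients.
\<close>

lemma integral_field_deriv:
  assumes d: "field_deriv i v w" and v: "continuous_on \<S> v" and w: "continuous_on \<S> w"
  shows "(\<integral>p. w p \<partial>\<sigma>) = 0"
proof -
  obtain B where B: "\<And>x. x \<in> \<S> \<Longrightarrow> \<bar>w x\<bar> \<le> B" using bounded_continuous_sphere[OF w] by blast
  define h :: "nat \<Rightarrow> real" where "h n = inverse (real (Suc n))" for n
  have h: "h n > 0" for n by (simp add: h_def)
  define s where "s n p = (v (rot i (h n) p) - v p) / h n" for n p
  have vrot: "continuous_on \<S> (\<lambda>p. v (rot i t p))" for t
    by (rule continuous_on_compose2[OF v continuous_rot]) auto
  have s: "continuous_on \<S> (s n)" for n
    unfolding s_def by (intro continuous_intros vrot v) (use h less_irrefl in metis)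
  have "(\<integral>p. s n p \<partial>\<sigma>) = 0" for n
    using integral_rot[OF v] by (simp add: s_def integrable_continuous_sphere vrot v)
  moreover have "(\<lambda>n. \<integral>p. s n p \<partial>\<sigma>) \<longlonglongrightarrow> (\<integral>p. w p \<partial>\<sigma>)"
  proof (rule integral_dominated_convergence[where w = "\<lambda>_. B"])
    show "AE p in \<sigma>. (\<lambda>n. s n p) \<longlonglongrightarrow> w p"
    proof (rule AE_I2)
      fix p assume "p \<in> space \<sigma>"
      then have "((\<lambda>t. (v (rot i (0 + t) p) - v (rot i 0 p)) / t) \<longlongrightarrow> w p) (at 0)"
        using d unfolding field_deriv_def DERIV_def by simp
      moreover have "filterlim h (at 0) sequentially"
        unfolding filterlim_at h_def using LIMSEQ_inverse_real_of_nat by auto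
      ultimately show "(\<lambda>n. s n p) \<longlonglongrightarrow> w p"
        using filterlim_compose by (fastforce simp: s_def)
    qed
    show "AE p in \<sigma>. norm (s n p) \<le> B" for n
    proof (rule AE_I2)
      fix p assume "p \<in> space \<sigma>"
      then have p: "p \<in> \<S>" by simp
      have "\<exists>z>0. z < h n \<and> v (rot i (h n) p) - v (rot i 0 p) = (h n - 0) * w (rot i z p)"
        by (rule MVT2) (use h field_deriv_flow[OF d p] in auto)
      then obtain z where "v (rot i (h n) p) - v (rot i 0 p) = (h n - 0) * w (rot i z p)" by blast
      then have "s n p = w (rot i z p)" using h[of n] by (simp add: s_def)
      then show "norm (s n p) \<le> B" using B[of "rot i z p"] p by simp
    qed
  qed (use s w in \<open>auto intro: borel_measurable_continuous_sphere\<close>)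
  ultimately show ?thesis by (simp add: LIMSEQ_const_iff)
qed

lemma field_deriv_add:
  assumes "field_deriv i v v'" "field_deriv i w w'"
  shows "field_deriv i (\<lambda>p. v p + w p) (\<lambda>p. v' p + w' p)"
  using assms unfolding field_deriv_def
  by (auto intro!: derivative_eq_intros dest!: bspec)

lemma field_deriv_mult:
  assumes "field_deriv i v v'" "field_deriv i w w'"
  shows "field_deriv i (\<lambda>p. v p * w p) (\<lambda>p. v' p * w p + v p * w' p)"
  using assms unfolding field_deriv_def
  by (auto intro!: derivative_eq_intros dest!: bspec)

lemma field_deriv_cmult:
  assumes "field_deriv i v v'"
  shows "field_deriv i (\<lambda>p. c * v p) (\<lambda>p. c * v' p)"
  using assms unfolding field_deriv_def
  by (auto intro!: derivative_eq_intros dest!: bspec)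

section \<open>Green's formula and the energy of a product\<close>

text \<open>
  Twice continuous differentiability along the three fields, with \<open>g\<close> the sum of the pure second
  derivatives. The derivatives enter as witnesses, determined and constrained on the sphere only, so
  that formulas obtained from the product rule can be supplied directly.
\<close>

definition has_laplacian :: "(real^4 \<Rightarrow> real) \<Rightarrow> (real^4 \<Rightarrow> real) \<Rightarrow> bool" where
  "has_laplacian u g \<longleftrightarrow> continuous_on \<S> u \<and>
     (\<exists>u1 u2. (\<forall>i<3. continuous_on \<S> (u1 i) \<and> continuous_on \<S> (u2 i) \<and>
                field_deriv i u (u1 i) \<and> field_deriv i (u1 i) (u2 i)) \<and>
              (\<forall>p\<in>\<S>. g p = (\<Sum>i<3. u2 i p)))"

lemma has_laplacianE:
  assumes "has_laplacian u g"
  obtains u1 u2 where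
    "\<And>i. i < 3 \<Longrightarrow> continuous_on \<S> (u1 i)" "\<And>i. i < 3 \<Longrightarrow> continuous_on \<S> (u2 i)"
    "\<And>i. i < 3 \<Longrightarrow> field_deriv i u (u1 i)" "\<And>i. i < 3 \<Longrightarrow> field_deriv i (u1 i) (u2 i)"
    "\<And>p. p \<in> \<S> \<Longrightarrow> g p = (\<Sum>i<3. u2 i p)"
  using assms unfolding has_laplacian_def by metis

lemma has_laplacianI:
  assumes "continuous_on \<S> u"
    "\<And>i. i < 3 \<Longrightarrow> continuous_on \<S> (u1 i)" "\<And>i. i < 3 \<Longrightarrow> continuous_on \<S> (u2 i)"
    "\<And>i. i < 3 \<Longrightarrow> field_deriv i u (u1 i)" "\<And>i. i < 3 \<Longrightarrow> field_deriv i (u1 i) (u2 i)"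
    "\<And>p. p \<in> \<S> \<Longrightarrow> g p = (\<Sum>i<3. u2 i p)"
  shows "has_laplacian u g"
  unfolding has_laplacian_def using assms by blast

lemma has_laplacian_continuous:
  assumes "has_laplacian u g"
  shows "continuous_on \<S> u" "continuous_on \<S> g"
proof -
  show "continuous_on \<S> u" using assms by (simp add: has_laplacian_def)
  obtain u2 where *: "\<And>i::nat. i < 3 \<Longrightarrow> continuous_on \<S> (u2 i)" "\<And>p. p \<in> \<S> \<Longrightarrow> g p = (\<Sum>i<3. u2 i p)"
    using assms by (rule has_laplacianE) blast
  have "continuous_on \<S> (\<lambda>p. \<Sum>i<3. u2 i p)"
    by (intro continuous_intros *) simp
  then show "continuous_on \<S> g" by (rule continuous_on_eq) (simp add: *)
qed

text \<open>
  \<open>u \<Delta>v - v \<Delta>u\<close> is the divergence of \<open>u grad v - v grad u\<close>.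
\<close>

lemma laplacian_symmetric:
  assumes u: "has_laplacian u g" and v: "has_laplacian v h"
  shows "(\<integral>p. u p * h p \<partial>\<sigma>) = (\<integral>p. v p * g p \<partial>\<sigma>)"
proof -
  obtain u1 u2 where u': "\<And>i. i < 3 \<Longrightarrow> continuous_on \<S> (u1 i)" "\<And>i. i < 3 \<Longrightarrow> continuous_on \<S> (u2 i)"
    "\<And>i. i < 3 \<Longrightarrow> field_deriv i u (u1 i)" "\<And>i. i < 3 \<Longrightarrow> field_deriv i (u1 i) (u2 i)"
    "\<And>p. p \<in> \<S> \<Longrightarrow> g p = (\<Sum>i<3. u2 i p)"
    using u by (rule has_laplacianE) blast
  obtain v1 v2 where v': "\<And>i. i < 3 \<Longrightarrow> continuous_on \<S> (v1 i)" "\<And>i. i < 3 \<Longrightarrow> continuous_on \<S> (v2 i)"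
    "\<And>i. i < 3 \<Longrightarrow> field_deriv i v (v1 i)" "\<And>i. i < 3 \<Longrightarrow> field_deriv i (v1 i) (v2 i)"
    "\<And>p. p \<in> \<S> \<Longrightarrow> h p = (\<Sum>i<3. v2 i p)"
    using v by (rule has_laplacianE) blast
  note cont = has_laplacian_continuous[OF u] has_laplacian_continuous[OF v]
  let ?w = "\<lambda>i p. (u1 i p * v1 i p + u p * v2 i p) + (-1) * (v1 i p * u1 i p + v p * u2 i p)"
  have "(\<integral>p. ?w i p \<partial>\<sigma>) = 0" if "i < 3" for i
  proof (rule integral_field_deriv)
    show "field_deriv i (\<lambda>p. u p * v1 i p + (-1) * (v p * u1 i p)) (?w i)"
      using that by (intro field_deriv_add field_deriv_cmult field_deriv_mult u' v')
  qed (use that in \<open>intro continuous_intros cont u' v'; simp\<close>)+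
  moreover have "integrable \<sigma> (?w i)" if "i < 3" for i
    using that by (intro integrable_continuous_sphere continuous_intros cont u' v') auto
  ultimately have "0 = (\<integral>p. (\<Sum>i<3. ?w i p) \<partial>\<sigma>)" by simp
  also have "\<dots> = (\<integral>p. u p * h p - v p * g p \<partial>\<sigma>)"
    by (intro Bochner_Integration.integral_cong refl)
       (simp add: u' v' sum_distrib_left sum_subtractf algebra_simps)
  also have "\<dots> = (\<integral>p. u p * h p \<partial>\<sigma>) - (\<integral>p. v p * g p \<partial>\<sigma>)"
    by (intro Bochner_Integration.integral_diff integrable_continuous_sphere continuous_intros cont)
  finally show ?thesis by simp
qed

text \<open>
  The lower bound for the Dirichlet integral of a product. The cross term \<open>2 u w (grad u \<bullet> grad w)\<close> is traded for a divergence and a nonnegative term by means of the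
  equation for \<open>w\<close>.
\<close>

lemma product_energy:
  assumes u: "has_laplacian u (\<lambda>p. - a * u p)" and w: "has_laplacian w (\<lambda>p. - b * w p)"
  obtains h where "has_laplacian (\<lambda>p. u p * w p) (\<lambda>p. - h p)"
    "a * (\<integral>p. (u p * w p)\<^sup>2 \<partial>\<sigma>) \<le> (\<integral>p. u p * w p * h p \<partial>\<sigma>)"
proof -
  obtain u1 u2 where u': "\<And>i. i < 3 \<Longrightarrow> continuous_on \<S> (u1 i)" "\<And>i. i < 3 \<Longrightarrow> continuous_on \<S> (u2 i)"
    "\<And>i. i < 3 \<Longrightarrow> field_deriv i u (u1 i)" "\<And>i. i < 3 \<Longrightarrow> field_deriv i (u1 i) (u2 i)"
    "\<And>p. p \<in> \<S> \<Longrightarrow> - a * u p = (\<Sum>i<3. u2 i p)"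
    using u by (rule has_laplacianE) blast
  obtain w1 w2 where w': "\<And>i. i < 3 \<Longrightarrow> continuous_on \<S> (w1 i)" "\<And>i. i < 3 \<Longrightarrow> continuous_on \<S> (w2 i)"
    "\<And>i. i < 3 \<Longrightarrow> field_deriv i w (w1 i)" "\<And>i. i < 3 \<Longrightarrow> field_deriv i (w1 i) (w2 i)"
    "\<And>p. p \<in> \<S> \<Longrightarrow> - b * w p = (\<Sum>i<3. w2 i p)"
    using w by (rule has_laplacianE) blast
  note cont = has_laplacian_continuous(1)[OF u] has_laplacian_continuous(1)[OF w]
  define F2 where "F2 i p = (u2 i p * w p + u1 i p * w1 i p) + (u1 i p * w1 i p + u p * w2 i p)" for i p
  define h where "h p = - (\<Sum>i<3. F2 i p)" for p
  \<comment> \<open>\<open>G i\<close> is the derivative of \<open>u\<^sup>2 w w1 i\<close>; the sum over \<open>i\<close> is \<open>div (u\<^sup>2 w grad w)\<close>.\<close>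
  define G where "G i p = ((u1 i p * u p + u p * u1 i p) * w p + (u p * u p) * w1 i p) * w1 i p
      + (u p * u p) * w p * w2 i p" for i p
  have lap: "has_laplacian (\<lambda>p. u p * w p) (\<lambda>p. - h p)"
  proof (rule has_laplacianI)
    show "field_deriv i (\<lambda>p. u p * w p) (\<lambda>p. u1 i p * w p + u p * w1 i p)" if "i < 3" for i
      using that by (intro field_deriv_mult u' w')
    show "field_deriv i (\<lambda>p. u1 i p * w p + u p * w1 i p) (F2 i)" if "i < 3" for i
      unfolding F2_def using that by (intro field_deriv_add field_deriv_mult u' w')
    show "- h p = (\<Sum>i<3. F2 i p)" for p by (simp add: h_def)
  qed (unfold F2_def, (intro continuous_intros cont u' w'; assumption?)+)
  have contG: "continuous_on \<S> (G i)" if "i < 3" for i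
    unfolding G_def using that by (intro continuous_intros cont u' w')
  have G: "(\<integral>p. G i p \<partial>\<sigma>) = 0" if i: "i < 3" for i
  proof (rule integral_field_deriv)
    show "field_deriv i (\<lambda>p. (u p * u p) * w p * w1 i p) (G i)"
      unfolding G_def using i by (intro field_deriv_mult u' w')
  qed (use i contG in \<open>auto intro!: continuous_intros cont u' w'\<close>)
  have contE: "continuous_on \<S> (\<lambda>p. (u p)\<^sup>2 * (\<Sum>i<3. (w1 i p)\<^sup>2))"
    by (intro continuous_intros cont w') simp
  have "u p * w p * h p = a * (u p * w p)\<^sup>2 + (u p)\<^sup>2 * (\<Sum>i<3. (w1 i p)\<^sup>2) - (\<Sum>i<3. G i p)"
    if "p \<in> \<S>" for p
  proof -
    have "u p * w p * h p + (\<Sum>i<3. G i p) =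
       u p * (w p)\<^sup>2 * - (\<Sum>i<3. u2 i p) + (u p)\<^sup>2 * (\<Sum>i<3. (w1 i p)\<^sup>2)"
      unfolding h_def F2_def G_def
      by (simp add: sum_distrib_left sum.distrib[symmetric] sum_negf[symmetric])
         (intro sum.cong refl, simp add: algebra_simps power2_eq_square)
    then show ?thesis by (simp add: u'(5)[OF that, symmetric] power2_eq_square algebra_simps)
  qed
  then have "(\<integral>p. u p * w p * h p \<partial>\<sigma>) =
     (\<integral>p. a * (u p * w p)\<^sup>2 + (u p)\<^sup>2 * (\<Sum>i<3. (w1 i p)\<^sup>2) - (\<Sum>i<3. G i p) \<partial>\<sigma>)"
    by (intro Bochner_Integration.integral_cong) auto
  also have "\<dots> = (\<integral>p. a * (u p * w p)\<^sup>2 \<partial>\<sigma>) + (\<integral>p. (u p)\<^sup>2 * (\<Sum>i<3. (w1 i p)\<^sup>2) \<partial>\<sigma>)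
      - (\<integral>p. (\<Sum>i<3. G i p) \<partial>\<sigma>)"
  proof -
    have "integrable \<sigma> (\<lambda>p. a * (u p * w p)\<^sup>2)"
      by (intro integrable_continuous_sphere continuous_intros cont)
    moreover have "integrable \<sigma> (\<lambda>p. \<Sum>i<3. G i p)"
      by (intro integrable_continuous_sphere continuous_intros contG) simp
    ultimately show ?thesis using integrable_continuous_sphere[OF contE] by simp
  qed
  also have "(\<integral>p. (\<Sum>i<3. G i p) \<partial>\<sigma>) = 0"
    using G contG by (simp add: integrable_continuous_sphere)
  finally have "(\<integral>p. u p * w p * h p \<partial>\<sigma>) = a * (\<integral>p. (u p * w p)\<^sup>2 \<partial>\<sigma>) + (\<integral>p. (u p)\<^sup>2 * (\<Sum>i<3. (w1 i p)\<^sup>2) \<partial>\<sigma>)"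
    by simp
  moreover have "0 \<le> (\<integral>p. (u p)\<^sup>2 * (\<Sum>i<3. (w1 i p)\<^sup>2) \<partial>\<sigma>)"
    by (intro integral_nonneg_AE AE_I2 mult_nonneg_nonneg sum_nonneg) auto
  ultimately show thesis using that[OF lap] by simp
qed

section \<open>The Laplace--Beltrami operator in the frame\<close>

lemma has_derivative_rot_imp_field_deriv:
  assumes "\<And>p. p \<in> \<S> \<Longrightarrow> (v has_derivative D p) (at p within \<S>)"
  shows "field_deriv i v (\<lambda>p. D p (quat_unit i p))"
  unfolding field_deriv_def
proof
  fix p assume p: "p \<in> \<S>"
  have sub: "range (\<lambda>t. rot i t p) \<subseteq> \<S>" using p by auto
  have "(v has_derivative D p) (at (rot i 0 p) within range (\<lambda>t. rot i t p))"
    using has_derivative_subset[OF assms[OF p] sub] by simp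
  from diff_chain_within[OF rot_has_derivative this]
  have "((\<lambda>t. v (rot i t p)) has_derivative (\<lambda>t. D p (t *\<^sub>R quat_unit i p))) (at 0)"
    by (simp add: o_def)
  moreover have "linear (D p)" using assms[OF p] by (simp add: has_derivative_linear)
  then have "(\<lambda>t. D p (t *\<^sub>R quat_unit i p)) = (*) (D p (quat_unit i p))"
    by (auto simp: linear_scale)
  ultimately show "((\<lambda>t. v (rot i t p)) has_real_derivative D p (quat_unit i p)) (at 0)"
    unfolding has_field_derivative_def by simp
qed

text \<open>
  The divergence is the trace of the tangential derivative of the gradient, and a trace may be computed
  in the quaternionic frame. Differentiating \<open>sphere_grad u p \<bullet> quat_unit i p\<close> along the same field
  gives the diagonal entry plus \<open>sphere_grad u p \<bullet> quat_unit i (quat_unit i p)\<close>, which is zero as the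
  frame squares to \<open>- p\<close> and the gradient is tangent.
\<close>

lemma has_laplacian_sphere_laplacian_real:
  assumes C2: "sphere_C2_real u"
  shows "has_laplacian u (sphere_laplacian_real u)"
proof -
  obtain D where D: "continuous_on \<S> D"
    "\<And>p. p \<in> \<S> \<Longrightarrow> (sphere_grad u has_derivative blinfun_apply (D p)) (at p within \<S>)"
    using C2 unfolding sphere_C2_real_def by blast
  define F where "F p = frechet_derivative u (at p within \<S>)" for p
  have F: "(u has_derivative F p) (at p within \<S>)" if "p \<in> \<S>" for p
    using C2 that unfolding sphere_C2_real_def differentiable_on_def F_def
    by (simp add: frechet_derivative_works)
  have contu: "continuous_on \<S> u"
    using C2 by (simp add: sphere_C2_real_def differentiable_imp_continuous_on)
  have contg: "continuous_on \<S> (sphere_grad u)"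
    using D(2) by (rule has_derivative_continuous_on)
  have tang: "tangent_proj p (quat_unit i p) = quat_unit i p" for p i
    by (simp add: tangent_proj_def)
  have tang_sa: "tangent_proj p a \<bullet> b = a \<bullet> tangent_proj p b" for p a b :: "real^4"
    by (simp add: tangent_proj_def inner_diff_left inner_diff_right inner_commute)
  have expand: "(\<Sum>b\<in>Basis. L (tangent_proj p b) *\<^sub>R b) \<bullet> v = L (tangent_proj p v)"
    if "linear L" for L :: "real^4 \<Rightarrow> real" and p v
  proof -
    have "linear (tangent_proj p)"
      unfolding tangent_proj_def by (rule linearI) (simp_all add: algebra_simps inner_add_left)
    then have lin: "linear (\<lambda>v. L (tangent_proj p v))"
      using linear_compose[OF _ that] by (simp add: o_def)
    have "L (tangent_proj p v) = L (tangent_proj p (\<Sum>b\<in>Basis. (v \<bullet> b) *\<^sub>R b))"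
      by (simp add: euclidean_representation)
    also have "\<dots> = (\<Sum>b\<in>Basis. (v \<bullet> b) *\<^sub>R L (tangent_proj p b))"
      by (simp only: linear_sum[OF lin] linear_scale[OF lin])
    finally show ?thesis by (simp add: inner_sum_right inner_commute mult.commute)
  qed
  have grad: "sphere_grad u p \<bullet> v = F p (tangent_proj p v)" if "p \<in> \<S>" for p v
    unfolding sphere_grad_def F_def[symmetric]
    using expand F[OF that] by (simp add: has_derivative_linear)
  have grad_tangent: "sphere_grad u p \<bullet> p = 0" if "p \<in> \<S>" for p
    using that grad[of p p] F[OF that] 
    by (simp add: tangent_proj_def norm_eq_1 linear_0 has_derivative_linear)
  let ?u1 = "\<lambda>i p. sphere_grad u p \<bullet> quat_unit i p"
  let ?u2 = "\<lambda>i p. D p (quat_unit i p) \<bullet> quat_unit i p"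
  show ?thesis
  proof (rule has_laplacianI[where ?u1.0 = ?u1 and ?u2.0 = ?u2])
    show "field_deriv i u (?u1 i)" for i
    proof -
      have "field_deriv i u (\<lambda>p. F p (quat_unit i p))"
        using F by (rule has_derivative_rot_imp_field_deriv)
      then show ?thesis by (simp add: field_deriv_def grad tang)
    qed
    show "field_deriv i (?u1 i) (?u2 i)" for i
    proof -
      have bl: "bounded_linear (quat_unit i)" using quat_unit_linear by (simp add: linear_conv_bounded_linear)
      have "field_deriv i (?u1 i) (\<lambda>p. sphere_grad u p \<bullet> quat_unit i (quat_unit i p) + D p (quat_unit i p) \<bullet> quat_unit i p)"
        by (rule has_derivative_rot_imp_field_deriv[where D = "\<lambda>p h. sphere_grad u p \<bullet> quat_unit i h + D p h \<bullet> quat_unit i p"])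
           (intro has_derivative_inner D bounded_linear.has_derivative[OF bl] has_derivative_ident, assumption)
      then show ?thesis by (simp add: field_deriv_def grad_tangent)
    qed
    show "sphere_laplacian_real u p = (\<Sum>i<3. ?u2 i p)" if p: "p \<in> \<S>" for p
    proof -
      have np: "norm p = 1" using p by simp
      have lin: "linear (D p)" by (simp add: blinfun.bounded_linear_right bounded_linear.linear)
      have "sphere_laplacian_real u p = (\<Sum>b\<in>Basis. tangent_proj p (D p (tangent_proj p b)) \<bullet> b)"
        unfolding sphere_laplacian_real_def by (rule sphere_div_eq[OF np D(2)[OF p]])
      also have "\<dots> = (\<Sum>b\<in>Basis. \<Sum>i<3. (b \<bullet> quat_unit i p) * (D p (quat_unit i p) \<bullet> tangent_proj p b))"
      proof (intro sum.cong refl)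
        fix b
        have "D p (tangent_proj p b) = (\<Sum>i<3. (b \<bullet> quat_unit i p) *\<^sub>R D p (quat_unit i p))"
          unfolding tangent_proj_quat_frame[OF np] by (simp add: linear_sum[OF lin] linear_scale[OF lin])
        then show "tangent_proj p (D p (tangent_proj p b)) \<bullet> b
            = (\<Sum>i<3. (b \<bullet> quat_unit i p) * (D p (quat_unit i p) \<bullet> tangent_proj p b))"
          by (simp add: tang_sa inner_sum_left)
      qed
      also have "\<dots> = (\<Sum>i<3. \<Sum>b\<in>Basis. (b \<bullet> quat_unit i p) * (tangent_proj p (D p (quat_unit i p)) \<bullet> b))"
        by (subst sum.swap) (simp add: tang_sa)
      also have "\<dots> = (\<Sum>i<3. quat_unit i p \<bullet> tangent_proj p (D p (quat_unit i p)))"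
        by (simp add: euclidean_inner[of "quat_unit _ p"] inner_commute)
      also have "\<dots> = (\<Sum>i<3. ?u2 i p)"
        by (simp add: tang_sa[symmetric] tang inner_commute[of "quat_unit _ p"])
      finally show ?thesis .
    qed
  qed (use contu contg D(1) in \<open>auto intro!: continuous_intros continuous_quat_unit\<close>)
qed

section \<open>Chebyshev polynomials as zonal eigenfunctions\<close>

text \<open>
  Chebyshev polynomials of the second kind, the characters of SU(2): at \<open>cos \<theta>\<close> the \<open>n\<close>-th one takes the
  value \<open>sin ((n + 1) \<theta>) / sin \<theta>\<close>.
\<close>

fun cheb :: "nat \<Rightarrow> real poly" where
  "cheb 0 = 1"
| "cheb (Suc 0) = [:0, 2:]"
| "cheb (Suc (Suc n)) = [:0, 2:] * cheb (Suc n) - cheb n"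

lemma cheb_three_term: "2 * t * poly (cheb (Suc n)) t = poly (cheb (Suc (Suc n))) t + poly (cheb n) t"
  by simp

lemma cheb_at_1 [simp]: "poly (cheb n) 1 = real n + 1"
  by (induction n rule: cheb.induct) auto

text \<open>
  The Clebsch--Gordan rule for characters of SU(2).
\<close>

lemma cheb_product:
  "poly (cheb (d + n)) t * poly (cheb n) t = (\<Sum>i\<le>n. poly (cheb (d + 2 * i)) t)"
proof (induction n arbitrary: d rule: cheb.induct)
  case 1
  then show ?case by simp
next
  case 2
  show ?case using cheb_three_term[of t d] by (simp add: algebra_simps)
next
  case (3 n)
  let ?U = "\<lambda>k. poly (cheb k) t"
  have "?U (d + Suc (Suc n)) * ?U (Suc (Suc n)) =
      2 * t * (?U (Suc d + Suc n) * ?U (Suc n)) - ?U (Suc (Suc d) + n) * ?U n"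
    by (simp add: algebra_simps)
  also have "\<dots> = 2 * t * (\<Sum>i\<le>Suc n. ?U (Suc (d + 2 * i))) - (\<Sum>i\<le>n. ?U (Suc (Suc d) + 2 * i))"
    using 3[of "Suc d"] 3[of "Suc (Suc d)"] by (simp only: add_Suc)
  also have "2 * t * (\<Sum>i\<le>Suc n. ?U (Suc (d + 2 * i))) =
      (\<Sum>i\<le>Suc n. ?U (Suc (Suc d) + 2 * i)) + (\<Sum>i\<le>Suc n. ?U (d + 2 * i))"
    unfolding sum_distrib_left cheb_three_term by (simp add: sum.distrib del: cheb.simps)
  finally show ?case by (simp del: cheb.simps)
qed

text \<open>
  Two first-order relations which prove each other by induction; together they give the differential
  equation.
\<close>

lemma cheb_deriv_relations:
  fixes t :: real and n :: nat
  defines "U \<equiv> \<lambda>n. poly (cheb n) t" and "U' \<equiv> \<lambda>n. poly (pderiv (cheb n)) t"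
  shows "t * U' (Suc n) - U' n = (real n + 1) * U (Suc n)" (is "?a n")
    and "U' (Suc n) - t * U' n = (real n + 2) * U n" (is "?b n")
proof -
  have rec: "U (Suc (Suc n)) = 2 * t * U (Suc n) - U n"
    "U' (Suc (Suc n)) = 2 * U (Suc n) + 2 * t * U' (Suc n) - U' n" for n
    by (simp_all add: U_def U'_def pderiv_mult pderiv_diff pderiv_pCons pderiv_smult)
  have "?a n \<and> ?b n"
  proof (induction n)
    case 0
    then show ?case by (simp add: U_def U'_def pderiv_pCons)
  next
    case (Suc n)
    then have a: "t * U' (Suc n) - U' n = (real n + 1) * U (Suc n)"
      and b: "U' (Suc n) - t * U' n = (real n + 2) * U n" by auto
    have "?b (Suc n)" using a by (simp add: rec algebra_simps)
    moreover have "?a (Suc n)"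
    proof -
      have U'n: "U' n = t * U' (Suc n) - (real n + 1) * U (Suc n)" using a by simp
      have "t * U' (Suc (Suc n)) - U' (Suc n)
          = t * (2 * U (Suc n) + t * U' (Suc n) + (real n + 1) * U (Suc n)) - U' (Suc n)"
        unfolding rec U'n by (simp add: algebra_simps)
      moreover have "t * (t * U' (Suc n)) - U' (Suc n) = t * (real n + 1) * U (Suc n) - (real n + 2) * U n"
        using b unfolding U'n by (simp add: algebra_simps)
      ultimately show ?thesis unfolding rec by (simp add: algebra_simps)
    qed
    ultimately show ?case by simp
  qed
  then show "?a n" "?b n" by auto
qed

lemma cheb_ode:
  "(1 - t\<^sup>2) * poly (pderiv (pderiv (cheb n))) t - 3 * (t * poly (pderiv (cheb n)) t)
     = - (real n * (real n + 2)) * poly (cheb n) t"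
proof (cases n)
  case 0
  then show ?thesis by simp
next
  case (Suc k)
  have "[:-1, 0, 1:] * pderiv (cheb (Suc k))
      = smult (real k + 1) ([:0, 1:] * cheb (Suc k)) - smult (real k + 2) (cheb k)" (is "?p = ?q")
  proof (rule poly_ext)
    fix s
    note r = cheb_deriv_relations[where t = s and n = k]
    have "s * (s * poly (pderiv (cheb (Suc k))) s - poly (pderiv (cheb k)) s)
        - (poly (pderiv (cheb (Suc k))) s - s * poly (pderiv (cheb k)) s)
        = s * ((real k + 1) * poly (cheb (Suc k)) s) - (real k + 2) * poly (cheb k) s"
      by (simp only: r)
    then show "poly ?p s = poly ?q s" by (simp add: algebra_simps)
  qed
  then have "poly (pderiv ?p) t = poly (pderiv ?q) t" by simp
  then have "(t\<^sup>2 - 1) * poly (pderiv (pderiv (cheb (Suc k)))) t + 2 * t * poly (pderiv (cheb (Suc k))) t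
     = (real k + 1) * (poly (cheb (Suc k)) t + t * poly (pderiv (cheb (Suc k))) t)
        - (real k + 2) * poly (pderiv (cheb k)) t"
    by (simp add: pderiv_mult pderiv_diff pderiv_smult pderiv_pCons power2_eq_square algebra_simps del: cheb.simps)
  moreover have "poly (pderiv (cheb k)) t = t * poly (pderiv (cheb (Suc k))) t - (real k + 1) * poly (cheb (Suc k)) t"
    using cheb_deriv_relations(1)[of t k] by simp
  ultimately show ?thesis unfolding Suc by (simp add: algebra_simps del: cheb.simps)
qed

lemma field_deriv_poly_inner:
  "field_deriv i (\<lambda>p. poly \<phi> (x \<bullet> p)) (\<lambda>p. poly (pderiv \<phi>) (x \<bullet> p) * (x \<bullet> quat_unit i p))"
  unfolding field_deriv_def rot_def inner_add_right inner_scaleR_right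
  by (auto intro!: derivative_eq_intros poly_DERIV[THEN DERIV_chain2])

lemma field_deriv_inner_quat:
  "field_deriv i (\<lambda>p. x \<bullet> quat_unit i p) (\<lambda>p. - (x \<bullet> p))"
  unfolding field_deriv_def rot_def linear_add[OF quat_unit_linear] linear_scale[OF quat_unit_linear]
    inner_add_right inner_scaleR_right
  by (auto intro!: derivative_eq_intros)

text \<open>
  The zonal part of the Laplacian: the frame turns \<open>\<phi> (x \<bullet> p)\<close> into \<open>\<phi>''\<close> times the squared length of the
  tangential part of \<open>x\<close>, minus three times the radial term.
\<close>

lemma has_laplacian_zonal:
  "has_laplacian (\<lambda>p. poly \<phi> (x \<bullet> p))
     (\<lambda>p. (x \<bullet> x - (x \<bullet> p)\<^sup>2) * poly (pderiv (pderiv \<phi>)) (x \<bullet> p) - 3 * ((x \<bullet> p) * poly (pderiv \<phi>) (x \<bullet> p)))"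
proof (rule has_laplacianI)
  show "field_deriv i (\<lambda>p. poly (pderiv \<phi>) (x \<bullet> p) * (x \<bullet> quat_unit i p))
      (\<lambda>p. (poly (pderiv (pderiv \<phi>)) (x \<bullet> p) * (x \<bullet> quat_unit i p)) * (x \<bullet> quat_unit i p)
         + poly (pderiv \<phi>) (x \<bullet> p) * - (x \<bullet> p))" for i
    by (intro field_deriv_mult field_deriv_poly_inner field_deriv_inner_quat)
  show "(x \<bullet> x - (x \<bullet> p)\<^sup>2) * poly (pderiv (pderiv \<phi>)) (x \<bullet> p) - 3 * ((x \<bullet> p) * poly (pderiv \<phi>) (x \<bullet> p))
      = (\<Sum>i<3. (poly (pderiv (pderiv \<phi>)) (x \<bullet> p) * (x \<bullet> quat_unit i p)) * (x \<bullet> quat_unit i p)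
         + poly (pderiv \<phi>) (x \<bullet> p) * - (x \<bullet> p))" if "p \<in> \<S>" for p
  proof -
    have e: "(\<Sum>i<3. (A * (x \<bullet> quat_unit i p)) * (x \<bullet> quat_unit i p) + B)
        = A * (\<Sum>i<3. (x \<bullet> quat_unit i p)\<^sup>2) + 3 * B" for A B :: real
      by (simp add: sum.distrib sum_distrib_left power2_eq_square mult.assoc)
    have "(\<Sum>i<3. (x \<bullet> quat_unit i p)\<^sup>2) = x \<bullet> x - (x \<bullet> p)\<^sup>2"
      using that by (intro quat_unit_parseval) simp
    then show ?thesis unfolding e by simp
  qed
qed (intro continuous_intros continuous_quat_unit field_deriv_poly_inner)+

lemma has_laplacian_cheb:
  assumes "x \<in> \<S>"
  shows "has_laplacian (\<lambda>p. poly (cheb n) (x \<bullet> p)) (\<lambda>p. - (real n * (real n + 2)) * poly (cheb n) (x \<bullet> p))"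
proof -
  have "x \<bullet> x = 1" using assms by (simp add: norm_eq_1)
  then show ?thesis using has_laplacian_zonal[of "cheb n" x] by (simp only: cheb_ode)
qed

section \<open>The reproducing formula\<close>

lemma inner_sphere_bounds:
  assumes "x \<in> \<S>" "y \<in> \<S>"
  shows "x \<bullet> y \<in> {-1..1}"
  using Cauchy_Schwarz_ineq2[of x y] assms by auto

text \<open>
  The three-term recursion shows that \<open>v\<close> is orthogonal to all powers of \<open>x \<bullet> y\<close>, and the Weierstrass
  theorem extends this to continuous functions of \<open>x \<bullet> y\<close>.
\<close>

lemma integral_continuous_inner_eq_0:
  fixes \<psi> :: "real \<Rightarrow> real"
  assumes v: "continuous_on \<S> v" and x: "x \<in> \<S>" and \<psi>: "continuous_on {-1..1} \<psi>"
    and zero: "\<And>j. (\<integral>y. poly (cheb j) (x \<bullet> y) * v y \<partial>\<sigma>) = 0"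
  shows "(\<integral>y. \<psi> (x \<bullet> y) * v y \<partial>\<sigma>) = 0"
proof -
  have int: "integrable \<sigma> (\<lambda>y. g (x \<bullet> y) * v y)" if "continuous_on {-1..1} g" for g :: "real \<Rightarrow> real"
    by (intro integrable_continuous_sphere continuous_intros v
        continuous_on_compose2[OF that]) (use inner_sphere_bounds[OF x] in auto)
  have pow: "(\<integral>y. (x \<bullet> y) ^ k * poly (cheb j) (x \<bullet> y) * v y \<partial>\<sigma>) = 0" for k j
  proof (induction k arbitrary: j)
    case 0
    then show ?case using zero by simp
  next
    case (Suc k)
    show ?case
    proof (cases j)
      case 0
      have "(\<integral>y. (x \<bullet> y) ^ Suc k * poly (cheb j) (x \<bullet> y) * v y \<partial>\<sigma>)
          = (\<integral>y. (1/2) * ((x \<bullet> y) ^ k * poly (cheb 1) (x \<bullet> y) * v y) \<partial>\<sigma>)"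
        using 0 by (intro Bochner_Integration.integral_cong) auto
      then show ?thesis using Suc[of 1] by (simp only: integral_mult_right_zero)
    next
      case j: (Suc l)
      have *: "integrable \<sigma> (\<lambda>y. (x \<bullet> y) ^ k * poly (cheb i) (x \<bullet> y) * v y)" for i
        by (rule int) (intro continuous_intros)
      have "(x \<bullet> y) ^ Suc k * poly (cheb j) (x \<bullet> y) * v y = (1/2) * ((x \<bullet> y) ^ k * poly (cheb (Suc j)) (x \<bullet> y) * v y)
          + (1/2) * ((x \<bullet> y) ^ k * poly (cheb l) (x \<bullet> y) * v y)" for y
      proof -
        have r: "poly (cheb (Suc j)) (x \<bullet> y) = 2 * (x \<bullet> y) * poly (cheb j) (x \<bullet> y) - poly (cheb l) (x \<bullet> y)"
          unfolding j using cheb_three_term[of "x \<bullet> y" l] by linarith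
        show ?thesis unfolding r by (simp add: algebra_simps)
      qed
      then have "(\<integral>y. (x \<bullet> y) ^ Suc k * poly (cheb j) (x \<bullet> y) * v y \<partial>\<sigma>)
          = (\<integral>y. (1/2) * ((x \<bullet> y) ^ k * poly (cheb (Suc j)) (x \<bullet> y) * v y)
             + (1/2) * ((x \<bullet> y) ^ k * poly (cheb l) (x \<bullet> y) * v y) \<partial>\<sigma>)"
        by (intro Bochner_Integration.integral_cong) auto
      also have "\<dots> = 0"
        using Suc[of "Suc j"] Suc[of l] by (subst Bochner_Integration.integral_add) (use * in auto)
      finally show ?thesis .
    qed
  qed
  obtain B where B: "\<And>y. y \<in> \<S> \<Longrightarrow> \<bar>v y\<bar> \<le> B" using bounded_continuous_sphere[OF v] by blast
  have small: "\<bar>\<integral>y. \<psi> (x \<bullet> y) * v y \<partial>\<sigma>\<bar> \<le> e * B" if e: "e > 0" for e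
  proof -
    obtain g where g: "real_polynomial_function g" "\<And>t. t \<in> {-1..1} \<Longrightarrow> \<bar>\<psi> t - g t\<bar> < e"
      using Stone_Weierstrass_real_polynomial_function[OF _ \<psi> e] by blast
    obtain a n where gs: "g = (\<lambda>t. \<Sum>i\<le>n. a i * t ^ i)"
      using g(1) real_polynomial_function_iff_sum by blast
    have contg: "continuous_on {-1..1} g" unfolding gs by (intro continuous_intros)
    have "(\<integral>y. g (x \<bullet> y) * v y \<partial>\<sigma>) = (\<integral>y. (\<Sum>i\<le>n. a i * ((x \<bullet> y) ^ i * poly (cheb 0) (x \<bullet> y) * v y)) \<partial>\<sigma>)"
      by (intro Bochner_Integration.integral_cong) (auto simp: gs sum_distrib_right mult.assoc)
    also have "\<dots> = (\<Sum>i\<le>n. a i * (\<integral>y. (x \<bullet> y) ^ i * poly (cheb 0) (x \<bullet> y) * v y \<partial>\<sigma>))"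
    proof -
      have "integrable \<sigma> (\<lambda>y. (x \<bullet> y) ^ i * poly (cheb 0) (x \<bullet> y) * v y)" for i
        by (rule int) (intro continuous_intros)
      then show ?thesis by (subst Bochner_Integration.integral_sum) auto
    qed
    also have "\<dots> = 0" by (simp only: pow) simp
    finally have "(\<integral>y. \<psi> (x \<bullet> y) * v y \<partial>\<sigma>) = (\<integral>y. \<psi> (x \<bullet> y) * v y - g (x \<bullet> y) * v y \<partial>\<sigma>)"
      using int[OF \<psi>] int[OF contg] by simp
    also have "\<bar>\<dots>\<bar> \<le> (\<integral>y. \<bar>\<psi> (x \<bullet> y) * v y - g (x \<bullet> y) * v y\<bar> \<partial>\<sigma>)"
      by (rule integral_abs_bound)
    also have "\<dots> \<le> (\<integral>y. e * B \<partial>\<sigma>)"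
    proof (rule integral_mono)
      show "\<bar>\<psi> (x \<bullet> y) * v y - g (x \<bullet> y) * v y\<bar> \<le> e * B" if "y \<in> space \<sigma>" for y
        using mult_mono[of "\<bar>\<psi> (x \<bullet> y) - g (x \<bullet> y)\<bar>" e "\<bar>v y\<bar>" B] that B[of y] e
          g(2)[OF inner_sphere_bounds[OF x, of y]] by (simp add: left_diff_distrib[symmetric] abs_mult)
    qed (use int[OF \<psi>] int[OF contg] in auto)
    finally show ?thesis by simp
  qed
  have "B \<ge> 0" using B[OF x] by linarith
  show ?thesis
  proof (rule ccontr)
    assume "(\<integral>y. \<psi> (x \<bullet> y) * v y \<partial>\<sigma>) \<noteq> 0" (is "?I \<noteq> 0")
    then have "\<bar>?I\<bar> \<le> \<bar>?I\<bar> / (2 * (B + 1)) * B" using \<open>B \<ge> 0\<close> by (intro small) auto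
    then have "(B + 2) * \<bar>?I\<bar> \<le> 0" using \<open>B \<ge> 0\<close> by (simp add: field_simps)
    then show False using \<open>B \<ge> 0\<close> \<open>?I \<noteq> 0\<close> by (auto simp: mult_le_0_iff)
  qed
qed

text \<open>
  Completeness of the zonal polynomials with pole \<open>x\<close>, tested at the pole only. Otherwise integrate \<open>v\<close>
  against a bump in \<open>x \<bullet> y\<close> supported in a cap around \<open>x\<close> on which \<open>v\<close> keeps its sign.
\<close>

lemma cheb_moments_unique:
  assumes v: "continuous_on \<S> v" and x: "x \<in> \<S>"
    and zero: "\<And>j. (\<integral>y. poly (cheb j) (x \<bullet> y) * v y \<partial>\<sigma>) = 0"
  shows "v x = 0"
proof (rule ccontr)
  assume nz: "v x \<noteq> 0"
  obtain \<delta> where \<delta>: "\<delta> > 0" "\<And>y. y \<in> \<S> \<Longrightarrow> dist y x < \<delta> \<Longrightarrow> dist (v y) (v x) < \<bar>v x\<bar>"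
    using v x nz unfolding continuous_on_iff by (metis zero_less_abs_iff)
  \<comment> \<open>\<open>\<psi> (x \<bullet> y) > 0\<close> exactly when \<open>y\<close> is closer to \<open>x\<close> than \<open>\<delta>\<close>, since \<open>|x - y|\<^sup>2 = 2 - 2 (x \<bullet> y)\<close>.\<close>
  define \<psi> where "\<psi> t = max 0 (t - (1 - \<delta>\<^sup>2 / 2))" for t :: real
  have cont\<psi>: "continuous_on A \<psi>" for A unfolding \<psi>_def by (intro continuous_intros)
  define g where "g y = \<psi> (x \<bullet> y) * v y * sgn (v x)" for y
  have "g x = 0"
  proof (rule nonneg_integral_zero_imp_zero)
    show "continuous_on \<S> g"
      unfolding g_def by (intro continuous_intros v continuous_on_compose2[OF cont\<psi>[of UNIV]]) auto
    show "(\<integral>y. g y \<partial>\<sigma>) = 0"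
      using integral_continuous_inner_eq_0[OF v x cont\<psi> zero] by (simp add: g_def)
    show "0 \<le> g y" if y: "y \<in> \<S>" for y
    proof (cases "x \<bullet> y \<le> 1 - \<delta>\<^sup>2 / 2")
      case True
      then show ?thesis by (simp add: g_def \<psi>_def)
    next
      case False
      have "(dist y x)\<^sup>2 = 2 - 2 * (x \<bullet> y)"
        using x y by (simp add: dist_norm power2_norm_eq_inner inner_diff_left inner_diff_right norm_eq_1 inner_commute)
      then have "(dist y x)\<^sup>2 < \<delta>\<^sup>2" using False by simp
      then have "dist y x < \<delta>" using \<delta>(1) by (simp add: power2_less_imp_less)
      then have "\<bar>v y - v x\<bar> < \<bar>v x\<bar>" using \<delta>(2)[OF y] by (simp add: dist_real_def)
      then have "0 \<le> v y * sgn (v x)" using nz by (auto simp: sgn_if split: if_splits)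
      then show ?thesis by (simp add: g_def \<psi>_def mult.assoc)
    qed
  qed (fact x)
  moreover have "x \<bullet> x = 1" using x by (simp add: norm_eq_1)
  ultimately show False using nz \<delta>(1) by (simp add: g_def \<psi>_def sgn_zero_iff)
qed

text \<open>
  Real solutions of the eigenvalue equation of degree \<open>m\<close>. The zero function is admitted, because the real or
  the imaginary part of a complex eigenfunction may vanish.
\<close>

definition sphere_harmonic :: "nat \<Rightarrow> (real^4 \<Rightarrow> real) \<Rightarrow> bool" where
  "sphere_harmonic m u \<longleftrightarrow> has_laplacian u (\<lambda>p. - (real m * (real m + 2)) * u p)"

lemma sphere_harmonic_continuous: "sphere_harmonic m u \<Longrightarrow> continuous_on \<S> u"
  unfolding sphere_harmonic_def by (rule has_laplacian_continuous)

lemma sphere_harmonic_cheb: "x \<in> \<S> \<Longrightarrow> sphere_harmonic n (\<lambda>y. poly (cheb n) (x \<bullet> y))"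
  unfolding sphere_harmonic_def by (rule has_laplacian_cheb)

lemma cheb_integral_laplacian:
  assumes x: "x \<in> \<S>" and F: "has_laplacian F (\<lambda>p. - h p)"
  shows "(\<integral>y. poly (cheb j) (x \<bullet> y) * h y \<partial>\<sigma>) = real j * (real j + 2) * (\<integral>y. poly (cheb j) (x \<bullet> y) * F y \<partial>\<sigma>)"
proof -
  have "(\<integral>y. poly (cheb j) (x \<bullet> y) * - h y \<partial>\<sigma>) = (\<integral>y. F y * (- (real j * (real j + 2)) * poly (cheb j) (x \<bullet> y)) \<partial>\<sigma>)"
    by (rule laplacian_symmetric[OF has_laplacian_cheb[OF x] F])
  also have "\<dots> = (\<integral>y. - (real j * (real j + 2)) * (poly (cheb j) (x \<bullet> y) * F y) \<partial>\<sigma>)"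
    by (simp only: mult_ac)
  finally show ?thesis by simp
qed

text \<open>
  Eigenfunctions of a symmetric operator with different eigenvalues are orthogonal; \<open>j (j + 2)\<close> is
  injective in \<open>j\<close>.
\<close>

lemma cheb_integral_orthogonal:
  assumes x: "x \<in> \<S>" and u: "sphere_harmonic m u" and "j \<noteq> m"
  shows "(\<integral>y. poly (cheb j) (x \<bullet> y) * u y \<partial>\<sigma>) = 0" (is "?I = 0")
proof -
  have "(\<integral>y. poly (cheb j) (x \<bullet> y) * (real m * (real m + 2) * u y) \<partial>\<sigma>) = real j * (real j + 2) * ?I"
    by (rule cheb_integral_laplacian[OF x]) (use u in \<open>simp add: sphere_harmonic_def\<close>)
  moreover have "(\<integral>y. poly (cheb j) (x \<bullet> y) * (real m * (real m + 2) * u y) \<partial>\<sigma>) = real m * (real m + 2) * ?I"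
    by (simp add: mult.left_commute[of _ "real m * (real m + 2)"])
  ultimately have "((real j + 1)\<^sup>2 - (real m + 1)\<^sup>2) * ?I = 0" by (simp add: power2_eq_square algebra_simps)
  moreover have "(real j + 1)\<^sup>2 \<noteq> (real m + 1)\<^sup>2"
    using \<open>j \<noteq> m\<close> by (auto simp: power2_eq_iff)
  ultimately show ?thesis by simp
qed

text \<open>
  In \<open>U\<^sub>m\<^sup>2 = \<Sum> U\<^sub>2\<^sub>i\<close> only the constant term \<open>U\<^sub>0\<close> has nonzero mean.
\<close>

lemma integral_cheb_square:
  assumes x: "x \<in> \<S>"
  shows "(\<integral>y. (poly (cheb m) (x \<bullet> y))\<^sup>2 \<partial>\<sigma>) = 1"
proof -
  have *: "(\<integral>y. poly (cheb j) (x \<bullet> y) \<partial>\<sigma>) = (if j = 0 then 1 else 0)" for j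
    using cheb_integral_orthogonal[OF x sphere_harmonic_cheb[OF x, of 0], of j] by simp
  have "(\<integral>y. (poly (cheb m) (x \<bullet> y))\<^sup>2 \<partial>\<sigma>) = (\<integral>y. (\<Sum>i\<le>m. poly (cheb (2 * i)) (x \<bullet> y)) \<partial>\<sigma>)"
    using cheb_product[of 0 m] by (simp add: power2_eq_square)
  also have "\<dots> = (\<Sum>i\<le>m. \<integral>y. poly (cheb (2 * i)) (x \<bullet> y) \<partial>\<sigma>)"
    by (intro Bochner_Integration.integral_sum integrable_continuous_sphere continuous_intros)
  also have "\<dots> = 1" unfolding * by (simp add: if_distrib sum.delta)
  finally show ?thesis .
qed

text \<open>
  Subtracting from \<open>u\<close> its component \<open>c\<close> along the zonal eigenfunction with pole \<open>x\<close> leaves a function whose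
  zonal moments at \<open>x\<close> all vanish, and which is therefore zero at \<open>x\<close>; the zonal eigenfunction has value
  \<open>m + 1\<close> at its pole.
\<close>

lemma sphere_harmonic_reproducing:
  assumes u: "sphere_harmonic m u" and x: "x \<in> \<S>"
  shows "u x = (real m + 1) * (\<integral>y. poly (cheb m) (x \<bullet> y) * u y \<partial>\<sigma>)"
proof -
  note cont = sphere_harmonic_continuous[OF u]
  define c where "c = (\<integral>y. poly (cheb m) (x \<bullet> y) * u y \<partial>\<sigma>)"
  have "u x - c * poly (cheb m) (x \<bullet> x) = 0"
  proof (rule cheb_moments_unique[OF _ x, of "\<lambda>y. u y - c * poly (cheb m) (x \<bullet> y)"])
    fix j
    have "(\<integral>y. poly (cheb j) (x \<bullet> y) * (u y - c * poly (cheb m) (x \<bullet> y)) \<partial>\<sigma>)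
        = (\<integral>y. poly (cheb j) (x \<bullet> y) * u y - c * (poly (cheb j) (x \<bullet> y) * poly (cheb m) (x \<bullet> y)) \<partial>\<sigma>)"
      by (simp add: algebra_simps)
    also have "\<dots> = (\<integral>y. poly (cheb j) (x \<bullet> y) * u y \<partial>\<sigma>) - c * (\<integral>y. poly (cheb j) (x \<bullet> y) * poly (cheb m) (x \<bullet> y) \<partial>\<sigma>)"
    proof -
      have "integrable \<sigma> (\<lambda>y. poly (cheb j) (x \<bullet> y) * u y)"
        by (intro integrable_continuous_sphere continuous_intros cont)
      moreover have "integrable \<sigma> (\<lambda>y. poly (cheb j) (x \<bullet> y) * poly (cheb m) (x \<bullet> y))"
        by (intro integrable_continuous_sphere continuous_intros)
      ultimately show ?thesis by simp
    qed
    also have "\<dots> = 0"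
    proof (cases "j = m")
      case True
      then show ?thesis using integral_cheb_square[OF x, of m] by (simp add: c_def power2_eq_square)
    next
      case False
      then show ?thesis
        using cheb_integral_orthogonal[OF x u] cheb_integral_orthogonal[OF x sphere_harmonic_cheb[OF x]] by simp
    qed
    finally show "(\<integral>y. poly (cheb j) (x \<bullet> y) * (u y - c * poly (cheb m) (x \<bullet> y)) \<partial>\<sigma>) = 0" .
  qed (intro continuous_intros cont)
  moreover have "x \<bullet> x = 1" using x by (simp add: norm_eq_1)
  ultimately show ?thesis by (simp add: c_def)
qed

text \<open>
  Orthogonality for different degrees, and the reproducing formula applied to a zonal eigenfunction for
  equal ones.
\<close>

lemma cheb_convolution:
  assumes x: "x \<in> \<S>" and z: "z \<in> \<S>"
  shows "(\<integral>y. poly (cheb j) (x \<bullet> y) * poly (cheb i) (z \<bullet> y) \<partial>\<sigma>)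
    = (if i = j then poly (cheb j) (x \<bullet> z) / (real j + 1) else 0)"
proof (cases "i = j")
  case True
  then show ?thesis
    using sphere_harmonic_reproducing[OF sphere_harmonic_cheb[OF z, of j] x]
    by (simp add: inner_commute field_simps)
next
  case False
  then show ?thesis
    using cheb_integral_orthogonal[OF x sphere_harmonic_cheb[OF z, of i], of j] by simp
qed

lemma Cauchy_Schwarz_integral:
  fixes f g :: "'b \<Rightarrow> real"
  assumes [simp]: "integrable M (\<lambda>x. (f x)\<^sup>2)" "integrable M (\<lambda>x. (g x)\<^sup>2)" "integrable M (\<lambda>x. f x * g x)"
  shows "(\<integral>x. f x * g x \<partial>M)\<^sup>2 \<le> (\<integral>x. (f x)\<^sup>2 \<partial>M) * (\<integral>x. (g x)\<^sup>2 \<partial>M)"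
proof -
  let ?A = "\<integral>x. (f x)\<^sup>2 \<partial>M" and ?B = "\<integral>x. (g x)\<^sup>2 \<partial>M" and ?C = "\<integral>x. f x * g x \<partial>M"
  have quad: "0 \<le> s\<^sup>2 * ?A + 2 * s * t * ?C + t\<^sup>2 * ?B" for s t
  proof -
    have "0 \<le> (\<integral>x. (s * f x + t * g x)\<^sup>2 \<partial>M)" by simp
    also have "\<dots> = (\<integral>x. s\<^sup>2 * (f x)\<^sup>2 + 2 * s * t * (f x * g x) + t\<^sup>2 * (g x)\<^sup>2 \<partial>M)"
      by (simp add: power2_eq_square algebra_simps)
    also have "\<dots> = s\<^sup>2 * ?A + 2 * s * t * ?C + t\<^sup>2 * ?B" by simp
    finally show ?thesis .
  qed
  have "?A \<ge> 0" by simp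
  show ?thesis
  proof (cases "?A = 0")
    case True
    have "?C = 0"
    proof (rule ccontr)
      assume "?C \<noteq> 0"
      then show False using quad[of "- (?B + 1) / (2 * ?C)" 1] True by (simp add: field_simps)
    qed
    then show ?thesis using True by simp
  next
    case False
    have "0 \<le> ?A * (?A * ?B - ?C\<^sup>2)"
      using quad[of "- ?C" ?A] by (simp add: power2_eq_square algebra_simps)
    then show ?thesis using False \<open>?A \<ge> 0\<close> by (simp add: zero_le_mult_iff)
  qed
qed

lemma sphere_harmonic_sup_bound:
  assumes u: "sphere_harmonic m u" and x: "x \<in> \<S>"
  shows "(u x)\<^sup>2 \<le> (real m + 1)\<^sup>2 * (\<integral>y. (u y)\<^sup>2 \<partial>\<sigma>)"
proof -
  note cont = sphere_harmonic_continuous[OF u]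
  have "(\<integral>y. poly (cheb m) (x \<bullet> y) * u y \<partial>\<sigma>)\<^sup>2
      \<le> (\<integral>y. (poly (cheb m) (x \<bullet> y))\<^sup>2 \<partial>\<sigma>) * (\<integral>y. (u y)\<^sup>2 \<partial>\<sigma>)"
    by (intro Cauchy_Schwarz_integral integrable_continuous_sphere continuous_intros cont)
  then show ?thesis
    unfolding sphere_harmonic_reproducing[OF u x] power_mult_distrib integral_cheb_square[OF x]
    by (simp add: mult_left_mono)
qed

section \<open>Zonal convolution\<close>

lemma integrable_bounded_pair_measure:
  fixes f :: "'a \<Rightarrow> 'b \<Rightarrow> real"
  assumes "finite_measure M" "finite_measure N"
    and "(\<lambda>(x, y). f x y) \<in> borel_measurable (M \<Otimes>\<^sub>M N)"
    and "\<And>x y. x \<in> space M \<Longrightarrow> y \<in> space N \<Longrightarrow> \<bar>f x y\<bar> \<le> B"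
  shows "integrable (M \<Otimes>\<^sub>M N) (\<lambda>(x, y). f x y)"
proof -
  interpret N: finite_measure N by fact
  interpret MN: finite_measure "M \<Otimes>\<^sub>M N"
    by (intro finite_measure_pair_measure assms)
  show ?thesis
    by (rule MN.integrable_const_bound[where B = B]) (use assms in \<open>auto simp: space_pair_measure\<close>)
qed

lemma Fubini_bounded:
  fixes f :: "'a \<Rightarrow> 'b \<Rightarrow> real"
  assumes "finite_measure M" "finite_measure N"
    and "(\<lambda>(x, y). f x y) \<in> borel_measurable (M \<Otimes>\<^sub>M N)"
    and "\<And>x y. x \<in> space M \<Longrightarrow> y \<in> space N \<Longrightarrow> \<bar>f x y\<bar> \<le> B"
  shows "(\<integral>x. (\<integral>y. f x y \<partial>N) \<partial>M) = (\<integral>y. (\<integral>x. f x y \<partial>M) \<partial>N)"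
proof -
  interpret M: finite_measure M by fact
  interpret N: finite_measure N by fact
  interpret pair_sigma_finite M N ..
  show ?thesis
    using Fubini_integral[OF integrable_bounded_pair_measure[OF assms]] by simp
qed

lemma measurable_poly_inner [measurable]:
  assumes [measurable]: "f \<in> measurable M \<sigma>" "g \<in> measurable M \<sigma>"
  shows "(\<lambda>q. poly \<phi> (f q \<bullet> g q)) \<in> borel_measurable M"
proof -
  have id [measurable]: "(\<lambda>x. x) \<in> borel_measurable \<sigma>"
    by (intro borel_measurable_continuous_sphere continuous_on_id)
  have [measurable]: "f \<in> borel_measurable M" "g \<in> borel_measurable M"
    using measurable_compose[OF assms(1) id] measurable_compose[OF assms(2) id] by auto
  have [measurable]: "poly \<phi> \<in> borel_measurable borel"
    by (intro borel_measurable_continuous_onI continuous_intros)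
  show ?thesis by measurable
qed

lemma poly_inner_bounded:
  obtains B where "\<And>x y. x \<in> \<S> \<Longrightarrow> y \<in> \<S> \<Longrightarrow> \<bar>poly \<phi> (x \<bullet> y)\<bar> \<le> B"
proof -
  have "compact (poly \<phi> ` {-1..1})" by (intro compact_continuous_image continuous_intros) auto
  then obtain B where "\<And>t. t \<in> {-1..1} \<Longrightarrow> \<bar>poly \<phi> t\<bar> \<le> B"
    unfolding compact_eq_bounded_closed bounded_iff by (metis imageI real_norm_def)
  then show thesis using inner_sphere_bounds by (intro that[of B]) blast
qed

text \<open>
  Up to the factor \<open>j + 1\<close>, the orthogonal projection of \<open>F\<close> onto the eigenfunctions of degree \<open>j\<close>.
\<close>

definition zonal_conv :: "nat \<Rightarrow> (real^4 \<Rightarrow> real) \<Rightarrow> real^4 \<Rightarrow> real" where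
  "zonal_conv j F x = (\<integral>y. poly (cheb j) (x \<bullet> y) * F y \<partial>\<sigma>)"

lemma zonal_conv_continuous:
  assumes F: "continuous_on \<S> F"
  shows "continuous_on \<S> (zonal_conv j F)"
proof -
  obtain B where B: "\<And>y. y \<in> \<S> \<Longrightarrow> \<bar>F y\<bar> \<le> B" using bounded_continuous_sphere[OF F] by blast
  obtain K where K: "\<And>x y. x \<in> \<S> \<Longrightarrow> y \<in> \<S> \<Longrightarrow> \<bar>poly (cheb j) (x \<bullet> y)\<bar> \<le> K"
    using poly_inner_bounded by blast
  show ?thesis
    unfolding continuous_on_sequentially
  proof (intro allI ballI impI)
    fix X a assume a: "a \<in> \<S>" and X: "(\<forall>n. X n \<in> \<S>) \<and> X \<longlonglongrightarrow> a"
    have "(\<lambda>n. zonal_conv j F (X n)) \<longlonglongrightarrow> zonal_conv j F a"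
      unfolding zonal_conv_def
    proof (rule integral_dominated_convergence[where w = "\<lambda>_. K * B"])
      show "AE y in \<sigma>. (\<lambda>n. poly (cheb j) (X n \<bullet> y) * F y) \<longlonglongrightarrow> poly (cheb j) (a \<bullet> y) * F y"
        by (intro AE_I2 tendsto_intros) (use X in auto)
      show "AE y in \<sigma>. norm (poly (cheb j) (X n \<bullet> y) * F y) \<le> K * B" for n
      proof (rule AE_I2)
        fix y assume "y \<in> space \<sigma>"
        then have "y \<in> \<S>" "X n \<in> \<S>" using X by (simp, blast)
        then show "norm (poly (cheb j) (X n \<bullet> y) * F y) \<le> K * B"
          using K[of "X n" y] B[of y] abs_ge_zero[of "poly (cheb j) (X n \<bullet> y)"]
          by (simp add: abs_mult mult_mono)
      qed
    qed (intro borel_measurable_continuous_sphere continuous_intros F | simp)+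
    then show "(zonal_conv j F \<circ> X) \<longlonglongrightarrow> zonal_conv j F a" by (simp add: o_def)
  qed
qed

lemma zonal_conv_self_adjoint:
  assumes F: "continuous_on \<S> F" and G: "continuous_on \<S> G"
  shows "(\<integral>x. G x * zonal_conv j F x \<partial>\<sigma>) = (\<integral>x. F x * zonal_conv j G x \<partial>\<sigma>)"
proof -
  obtain B where B: "\<And>y. y \<in> \<S> \<Longrightarrow> \<bar>F y\<bar> \<le> B" using bounded_continuous_sphere[OF F] by blast
  obtain C where C: "\<And>y. y \<in> \<S> \<Longrightarrow> \<bar>G y\<bar> \<le> C" using bounded_continuous_sphere[OF G] by blast
  obtain K where K: "\<And>x y. x \<in> \<S> \<Longrightarrow> y \<in> \<S> \<Longrightarrow> \<bar>poly (cheb j) (x \<bullet> y)\<bar> \<le> K"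
    using poly_inner_bounded by blast
  have [measurable]: "F \<in> borel_measurable \<sigma>" "G \<in> borel_measurable \<sigma>"
    using F G borel_measurable_continuous_sphere by auto
  have "(\<integral>x. (\<integral>y. G x * (poly (cheb j) (x \<bullet> y) * F y) \<partial>\<sigma>) \<partial>\<sigma>)
      = (\<integral>y. (\<integral>x. G x * (poly (cheb j) (x \<bullet> y) * F y) \<partial>\<sigma>) \<partial>\<sigma>)"
  proof (rule Fubini_bounded[OF sphere_measure.finite_measure_axioms sphere_measure.finite_measure_axioms])
    show "\<bar>G x * (poly (cheb j) (x \<bullet> y) * F y)\<bar> \<le> C * (K * B)"
      if "x \<in> space \<sigma>" "y \<in> space \<sigma>" for x y
    proof -
      have xy: "x \<in> \<S>" "y \<in> \<S>" using that by auto
      show ?thesis unfolding abs_mult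
        using K[OF xy] B[OF xy(2)] C[OF xy(1)] by (intro mult_mono) auto
    qed
  qed measurable
  then show ?thesis
    by (simp add: zonal_conv_def inner_commute mult_ac
        flip: Bochner_Integration.integral_mult_right_zero)
qed

lemma zonal_conv_zonal_conv:
  assumes F: "continuous_on \<S> F" and x: "x \<in> \<S>"
  shows "zonal_conv l (zonal_conv j F) x = (if l = j then zonal_conv j F x / (real j + 1) else 0)"
proof -
  have "zonal_conv l (zonal_conv j F) x = (\<integral>y. F y * zonal_conv j (\<lambda>y. poly (cheb l) (x \<bullet> y)) y \<partial>\<sigma>)"
    unfolding zonal_conv_def[of l]
    by (rule zonal_conv_self_adjoint) (intro F continuous_intros)+
  also have "\<dots> = (\<integral>y. F y * (if l = j then poly (cheb j) (x \<bullet> y) / (real j + 1) else 0) \<partial>\<sigma>)"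
  proof (intro Bochner_Integration.integral_cong refl)
    fix y assume "y \<in> space \<sigma>"
    then have "zonal_conv j (\<lambda>y. poly (cheb l) (x \<bullet> y)) y = (if l = j then poly (cheb j) (y \<bullet> x) / (real j + 1) else 0)"
      unfolding zonal_conv_def by (subst cheb_convolution) (use x in auto)
    then show "F y * zonal_conv j (\<lambda>y. poly (cheb l) (x \<bullet> y)) y
        = F y * (if l = j then poly (cheb j) (x \<bullet> y) / (real j + 1) else 0)"
      by (simp add: inner_commute)
  qed
  also have "\<dots> = (if l = j then zonal_conv j F x / (real j + 1) else 0)"
    by (simp add: zonal_conv_def mult.commute)
  finally show ?thesis .
qed

text \<open>
  \<open>(j + 1) * zonal_conv j\<close> is a self-adjoint idempotent.
\<close>

lemma zonal_conv_nonneg: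
  assumes F: "continuous_on \<S> F"
  shows "0 \<le> (\<integral>x. F x * zonal_conv j F x \<partial>\<sigma>)"
proof -
  have "(\<integral>x. F x * zonal_conv j F x \<partial>\<sigma>) = (\<integral>x. F x * ((real j + 1) * zonal_conv j (zonal_conv j F) x) \<partial>\<sigma>)"
    by (intro Bochner_Integration.integral_cong refl) (simp add: zonal_conv_zonal_conv[OF F])
  also have "\<dots> = (real j + 1) * (\<integral>x. F x * zonal_conv j (zonal_conv j F) x \<partial>\<sigma>)"
    by (simp add: mult.left_commute[of _ "real j + 1"])
  also have "(\<integral>x. F x * zonal_conv j (zonal_conv j F) x \<partial>\<sigma>) = (\<integral>x. zonal_conv j F x * zonal_conv j F x \<partial>\<sigma>)"
    by (rule zonal_conv_self_adjoint[OF zonal_conv_continuous[OF F] F])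
  finally show ?thesis by simp
qed

section \<open>Products of two real eigenfunctions\<close>

text \<open>
  Insert the reproducing formulas for \<open>u\<close> and \<open>w\<close> and exchange integrals, so that the left side becomes the
  inner product of \<open>U (y, z) = u y * w z\<close> with \<open>\<Phi> (y, z) = \<integral> h x K\<^sub>m(x, y) K\<^sub>n(x, z) d\<sigma>(x)\<close>, where \<open>K\<^sub>m\<close>
  and \<open>K\<^sub>n\<close> are the reproducing kernels. In \<open>\<integral> \<Phi>\<^sup>2\<close> the variables \<open>y\<close> and \<open>z\<close> separate, and each
  integral composes a kernel with itself, leaving \<open>K\<^sub>m K\<^sub>n\<close> on the sphere. The gain over bounding the factors
  one by one is that the product of the kernels is evaluated at the same pair of points.
\<close>

lemma product_duality:
  assumes u: "sphere_harmonic m u" and w: "sphere_harmonic n w" and h: "continuous_on \<S> h"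
  shows "(\<integral>x. u x * w x * h x \<partial>\<sigma>)\<^sup>2 \<le> (real m + 1) * (real n + 1) * (\<integral>x. (u x)\<^sup>2 \<partial>\<sigma>) * (\<integral>x. (w x)\<^sup>2 \<partial>\<sigma>)
     * (\<integral>x. h x * (\<integral>z. poly (cheb m) (x \<bullet> z) * poly (cheb n) (x \<bullet> z) * h z \<partial>\<sigma>) \<partial>\<sigma>)"
proof -
  let ?P = "\<sigma> \<Otimes>\<^sub>M \<sigma>"
  note cu = sphere_harmonic_continuous[OF u] and cw = sphere_harmonic_continuous[OF w]
  have fin: "finite_measure \<sigma>" by (rule sphere_measure.finite_measure_axioms)
  then have finP: "finite_measure ?P" by (intro finite_measure_pair_measure)
  interpret P: finite_measure ?P by (rule finP)
  have [measurable]: "u \<in> borel_measurable \<sigma>" "w \<in> borel_measurable \<sigma>" "h \<in> borel_measurable \<sigma>"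
    using cu cw h borel_measurable_continuous_sphere by auto
  obtain Bu where Bu: "\<And>y. y \<in> \<S> \<Longrightarrow> \<bar>u y\<bar> \<le> Bu" using bounded_continuous_sphere[OF cu] by blast
  obtain Bw where Bw: "\<And>y. y \<in> \<S> \<Longrightarrow> \<bar>w y\<bar> \<le> Bw" using bounded_continuous_sphere[OF cw] by blast
  obtain Bh where Bh: "\<And>y. y \<in> \<S> \<Longrightarrow> \<bar>h y\<bar> \<le> Bh" using bounded_continuous_sphere[OF h] by blast
  obtain Bm where Bm: "\<And>x y. x \<in> \<S> \<Longrightarrow> y \<in> \<S> \<Longrightarrow> \<bar>poly (cheb m) (x \<bullet> y)\<bar> \<le> Bm"
    using poly_inner_bounded by blast
  obtain Bn where Bn: "\<And>x y. x \<in> \<S> \<Longrightarrow> y \<in> \<S> \<Longrightarrow> \<bar>poly (cheb n) (x \<bullet> y)\<bar> \<le> Bn"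
    using poly_inner_bounded by blast
  define c where "c = (real m + 1) * (real n + 1)"
  define U where "U q = u (fst q) * w (snd q)" for q :: "(real^4) \<times> (real^4)"
  define a where "a x q = c * h x * (poly (cheb m) (x \<bullet> fst q) * poly (cheb n) (x \<bullet> snd q))"
    for x and q :: "(real^4) \<times> (real^4)"
  define \<Phi> where "\<Phi> q = (\<integral>x. a x q \<partial>\<sigma>)" for q
  have mU [measurable]: "U \<in> borel_measurable ?P" unfolding U_def by measurable
  have ma [measurable]: "(\<lambda>(x, q). a x q) \<in> borel_measurable (\<sigma> \<Otimes>\<^sub>M ?P)" unfolding a_def by measurable
  have m\<Phi> [measurable]: "\<Phi> \<in> borel_measurable ?P" unfolding \<Phi>_def a_def by measurable
  have c0: "c \<ge> 0" by (simp add: c_def)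
  define A where "A = c * Bh * (Bm * Bn)"
  have Ba: "\<bar>a x q\<bar> \<le> A" if "x \<in> \<S>" "q \<in> space ?P" for x q
  proof -
    have q: "fst q \<in> \<S>" "snd q \<in> \<S>" using that by (auto simp: space_pair_measure)
    show ?thesis unfolding a_def A_def abs_mult
      using Bh[OF that(1)] Bm[OF that(1) q(1)] Bn[OF that(1) q(2)] c0 by (intro mult_mono) auto
  qed
  have BU: "\<bar>U q\<bar> \<le> Bu * Bw" if "q \<in> space ?P" for q
  proof -
    have q: "fst q \<in> \<S>" "snd q \<in> \<S>" using that by (auto simp: space_pair_measure)
    show ?thesis unfolding U_def abs_mult
      using Bu[OF q(1)] Bw[OF q(2)] by (intro mult_mono) auto
  qed
  have inta: "integrable \<sigma> (\<lambda>x. a x q)" for q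
    unfolding a_def by (intro integrable_continuous_sphere continuous_intros h)
  have B\<Phi>: "\<bar>\<Phi> q\<bar> \<le> A" if "q \<in> space ?P" for q
  proof -
    have "\<bar>\<Phi> q\<bar> \<le> (\<integral>x. \<bar>a x q\<bar> \<partial>\<sigma>)" unfolding \<Phi>_def by (rule integral_abs_bound)
    also have "\<dots> \<le> (\<integral>x. A \<partial>\<sigma>)"
      by (rule integral_mono) (use inta Ba that in auto)
    finally show ?thesis by simp
  qed
  have prod: "(\<integral>q. f (fst q) * g (snd q) \<partial>?P) = (\<integral>y. f y \<partial>\<sigma>) * (\<integral>z. g z \<partial>\<sigma>)"
    if f: "continuous_on \<S> f" and g: "continuous_on \<S> g" for f g :: "real^4 \<Rightarrow> real"
  proof -
    have [measurable]: "f \<in> borel_measurable \<sigma>" "g \<in> borel_measurable \<sigma>"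
      using f g borel_measurable_continuous_sphere by auto
    obtain Bf where Bf: "\<And>y. y \<in> \<S> \<Longrightarrow> \<bar>f y\<bar> \<le> Bf" using bounded_continuous_sphere[OF f] by blast
    obtain Bg where Bg: "\<And>y. y \<in> \<S> \<Longrightarrow> \<bar>g y\<bar> \<le> Bg" using bounded_continuous_sphere[OF g] by blast
    have "integrable ?P (\<lambda>(y, z). f y * g z)"
    proof (rule integrable_bounded_pair_measure[OF fin fin])
      show "\<bar>f y * g z\<bar> \<le> Bf * Bg" if "y \<in> space \<sigma>" "z \<in> space \<sigma>" for y z
      proof -
        have yz: "y \<in> \<S>" "z \<in> \<S>" using that by auto
        show ?thesis unfolding abs_mult using Bf[OF yz(1)] Bg[OF yz(2)] by (intro mult_mono) auto
      qed
    qed measurable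
    from sphere_pair.integral_fst[OF this] show ?thesis
      by (simp add: case_prod_unfold)
  qed
  have "(\<integral>x. u x * w x * h x \<partial>\<sigma>) = (\<integral>x. (\<integral>q. a x q * U q \<partial>?P) \<partial>\<sigma>)"
  proof (intro Bochner_Integration.integral_cong refl)
    fix x assume "x \<in> space \<sigma>"
    then have x: "x \<in> \<S>" by simp
    have "(\<integral>q. a x q * U q \<partial>?P)
        = (\<integral>q. c * h x * ((poly (cheb m) (x \<bullet> fst q) * u (fst q)) * (poly (cheb n) (x \<bullet> snd q) * w (snd q))) \<partial>?P)"
      by (simp add: a_def U_def mult_ac)
    also have "\<dots> = c * h x * ((\<integral>y. poly (cheb m) (x \<bullet> y) * u y \<partial>\<sigma>) * (\<integral>z. poly (cheb n) (x \<bullet> z) * w z \<partial>\<sigma>))"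
      using prod[of "\<lambda>y. poly (cheb m) (x \<bullet> y) * u y" "\<lambda>z. poly (cheb n) (x \<bullet> z) * w z"]
      by (simp add: continuous_intros cu cw)
    finally show "u x * w x * h x = (\<integral>q. a x q * U q \<partial>?P)"
      unfolding sphere_harmonic_reproducing[OF u x] sphere_harmonic_reproducing[OF w x] c_def
      by (simp add: mult_ac)
  qed
  also have "\<dots> = (\<integral>q. (\<integral>x. a x q * U q \<partial>\<sigma>) \<partial>?P)"
  proof (rule Fubini_bounded[OF fin finP])
    show "\<bar>a x q * U q\<bar> \<le> A * (Bu * Bw)" if "x \<in> space \<sigma>" "q \<in> space ?P" for x q
    proof -
      have x: "x \<in> \<S>" using that by simp
      show ?thesis unfolding abs_mult using Ba[OF x that(2)] BU[OF that(2)] by (intro mult_mono) auto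
    qed
  qed measurable
  also have "\<dots> = (\<integral>q. U q * \<Phi> q \<partial>?P)" by (simp add: \<Phi>_def mult.commute)
  finally have "(\<integral>x. u x * w x * h x \<partial>\<sigma>)\<^sup>2 = (\<integral>q. U q * \<Phi> q \<partial>?P)\<^sup>2" by simp
  also have "\<dots> \<le> (\<integral>q. (U q)\<^sup>2 \<partial>?P) * (\<integral>q. (\<Phi> q)\<^sup>2 \<partial>?P)"
  proof (rule Cauchy_Schwarz_integral)
    have bd: "integrable ?P (\<lambda>q. f q * g q)"
      if "f \<in> borel_measurable ?P" "g \<in> borel_measurable ?P" 
        "\<And>q. q \<in> space ?P \<Longrightarrow> \<bar>f q\<bar> \<le> K" "\<And>q. q \<in> space ?P \<Longrightarrow> \<bar>g q\<bar> \<le> L" for f g :: "(real^4) \<times> (real^4) \<Rightarrow> real" and K L :: real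
    proof (rule P.integrable_const_bound[where B = "K * L"])
      show "AE q in ?P. norm (f q * g q) \<le> K * L"
      proof (rule AE_I2)
        fix q assume "q \<in> space ?P"
        then show "norm (f q * g q) \<le> K * L"
          unfolding real_norm_def abs_mult using that(3,4)[of q] by (intro mult_mono) auto
      qed
    qed (use that in measurable)
    show "integrable ?P (\<lambda>q. (U q)\<^sup>2)" "integrable ?P (\<lambda>q. (\<Phi> q)\<^sup>2)" "integrable ?P (\<lambda>q. U q * \<Phi> q)"
      unfolding power2_eq_square by (rule bd[OF mU mU BU BU] bd[OF m\<Phi> m\<Phi> B\<Phi> B\<Phi>] bd[OF mU m\<Phi> BU B\<Phi>]; assumption)+
  qed
  also have "(\<integral>q. (U q)\<^sup>2 \<partial>?P) = (\<integral>x. (u x)\<^sup>2 \<partial>\<sigma>) * (\<integral>x. (w x)\<^sup>2 \<partial>\<sigma>)"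
    unfolding U_def power_mult_distrib by (rule prod) (intro continuous_intros cu cw)+
  also have "(\<integral>q. (\<Phi> q)\<^sup>2 \<partial>?P) = (\<integral>q. (\<integral>x. a x q * \<Phi> q \<partial>\<sigma>) \<partial>?P)"
    by (simp add: power2_eq_square \<Phi>_def)
  also have "\<dots> = (\<integral>x. (\<integral>q. a x q * \<Phi> q \<partial>?P) \<partial>\<sigma>)"
  proof (rule Fubini_bounded[OF fin finP, symmetric])
    show "\<bar>a x q * \<Phi> q\<bar> \<le> A * A" if "x \<in> space \<sigma>" "q \<in> space ?P" for x q
    proof -
      have x: "x \<in> \<S>" using that by simp
      show ?thesis unfolding abs_mult using Ba[OF x that(2)] B\<Phi>[OF that(2)] by (intro mult_mono) auto
    qed
  qed measurable
  also have "\<dots> = (\<integral>x. c * (h x * (\<integral>z. poly (cheb m) (x \<bullet> z) * poly (cheb n) (x \<bullet> z) * h z \<partial>\<sigma>)) \<partial>\<sigma>)"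
  proof (intro Bochner_Integration.integral_cong refl)
    fix x assume "x \<in> space \<sigma>"
    then have x: "x \<in> \<S>" by simp
    have "(\<integral>q. a x q * \<Phi> q \<partial>?P) = (\<integral>q. (\<integral>z. a x q * a z q \<partial>\<sigma>) \<partial>?P)" by (simp add: \<Phi>_def)
    also have "\<dots> = (\<integral>z. (\<integral>q. a x q * a z q \<partial>?P) \<partial>\<sigma>)"
    proof (rule Fubini_bounded[OF fin finP, symmetric])
      have [measurable]: "x \<in> space \<sigma>" using x by simp
      have [measurable]: "a x \<in> borel_measurable ?P" unfolding a_def by measurable
      show "(\<lambda>(z, q). a x q * a z q) \<in> borel_measurable (\<sigma> \<Otimes>\<^sub>M ?P)" by measurable
      show "\<bar>a x q * a z q\<bar> \<le> A * A" if "z \<in> space \<sigma>" "q \<in> space ?P" for z q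
      proof -
        have z: "z \<in> \<S>" using that by simp
        show ?thesis unfolding abs_mult using Ba[OF x that(2)] Ba[OF z that(2)] by (intro mult_mono) auto
      qed
    qed
    also have "\<dots> = (\<integral>z. c * h x * (poly (cheb m) (x \<bullet> z) * poly (cheb n) (x \<bullet> z) * h z) \<partial>\<sigma>)"
    proof (intro Bochner_Integration.integral_cong refl)
      fix z assume "z \<in> space \<sigma>"
      then have z: "z \<in> \<S>" by simp
      have "(\<integral>q. a x q * a z q \<partial>?P) = (\<integral>q. c\<^sup>2 * h x * h z *
          ((poly (cheb m) (x \<bullet> fst q) * poly (cheb m) (z \<bullet> fst q)) * (poly (cheb n) (x \<bullet> snd q) * poly (cheb n) (z \<bullet> snd q))) \<partial>?P)"
        by (simp add: a_def power2_eq_square mult_ac)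
      also have "\<dots> = c\<^sup>2 * h x * h z * ((\<integral>y. poly (cheb m) (x \<bullet> y) * poly (cheb m) (z \<bullet> y) \<partial>\<sigma>)
          * (\<integral>y. poly (cheb n) (x \<bullet> y) * poly (cheb n) (z \<bullet> y) \<partial>\<sigma>))"
        using prod[of "\<lambda>y. poly (cheb m) (x \<bullet> y) * poly (cheb m) (z \<bullet> y)" "\<lambda>y. poly (cheb n) (x \<bullet> y) * poly (cheb n) (z \<bullet> y)"]
        by (simp add: continuous_intros)
      also have "\<dots> = c * h x * (poly (cheb m) (x \<bullet> z) * poly (cheb n) (x \<bullet> z) * h z)"
      proof -
        have "(M * N)\<^sup>2 * p * q * (a / M * (b / N)) = M * N * p * (a * b * q)"
          if "M \<noteq> 0" "N \<noteq> 0" for M N p q a b :: real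
          using that by (simp add: power2_eq_square)
        from this[of "real m + 1" "real n + 1"] show ?thesis
          unfolding cheb_convolution[OF x z] c_def by simp
      qed
      finally show "(\<integral>q. a x q * a z q \<partial>?P) = \<dots>" .
    qed
    finally show "(\<integral>q. a x q * \<Phi> q \<partial>?P) = c * (h x * (\<integral>z. poly (cheb m) (x \<bullet> z) * poly (cheb n) (x \<bullet> z) * h z \<partial>\<sigma>))"
      by simp
  qed
  also have "\<dots> = c * (\<integral>x. h x * (\<integral>z. poly (cheb m) (x \<bullet> z) * poly (cheb n) (x \<bullet> z) * h z \<partial>\<sigma>) \<partial>\<sigma>)"
    by (rule integral_mult_right_zero)
  finally show ?thesis by (simp only: c_def mult_ac)
qed

lemma product_duality_zonal:
  assumes u: "sphere_harmonic (d + n) u" and w: "sphere_harmonic n w" and h: "continuous_on \<S> h"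
  shows "(\<integral>x. u x * w x * h x \<partial>\<sigma>)\<^sup>2
     \<le> (real (d + n) + 1) * (real n + 1) * (\<integral>x. (u x)\<^sup>2 \<partial>\<sigma>) * (\<integral>x. (w x)\<^sup>2 \<partial>\<sigma>)
       * (\<Sum>i\<le>n. \<integral>x. h x * zonal_conv (d + 2 * i) h x \<partial>\<sigma>)"
proof -
  have "(\<integral>z. poly (cheb (d + n)) (x \<bullet> z) * poly (cheb n) (x \<bullet> z) * h z \<partial>\<sigma>) = (\<Sum>i\<le>n. zonal_conv (d + 2 * i) h x)" for x
    unfolding cheb_product sum_distrib_right zonal_conv_def
    by (intro Bochner_Integration.integral_sum integrable_continuous_sphere continuous_intros h)
  then have "(\<integral>x. h x * (\<integral>z. poly (cheb (d + n)) (x \<bullet> z) * poly (cheb n) (x \<bullet> z) * h z \<partial>\<sigma>) \<partial>\<sigma>)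
      = (\<integral>x. (\<Sum>i\<le>n. h x * zonal_conv (d + 2 * i) h x) \<partial>\<sigma>)"
    by (simp add: sum_distrib_left)
  also have "\<dots> = (\<Sum>i\<le>n. \<integral>x. h x * zonal_conv (d + 2 * i) h x \<partial>\<sigma>)"
    by (intro Bochner_Integration.integral_sum integrable_continuous_sphere continuous_intros h zonal_conv_continuous)
  finally show ?thesis using product_duality[OF u w h] by simp
qed

text \<open>
  Test the duality bound with the zonal function of degree \<open>l\<close>: its projections onto the degrees of the
  Clebsch--Gordan range are zero, so the right side vanishes.
\<close>

lemma product_frequency_range:
  assumes u: "sphere_harmonic (d + n) u" and w: "sphere_harmonic n w"
    and l: "\<And>i. i \<le> n \<Longrightarrow> l \<noteq> d + 2 * i" and x: "x \<in> \<S>"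
  shows "zonal_conv l (\<lambda>y. u y * w y) x = 0"
proof -
  let ?h = "\<lambda>y. poly (cheb l) (x \<bullet> y)"
  have "zonal_conv (d + 2 * i) ?h y = 0" if "i \<le> n" "y \<in> \<S>" for i y
    unfolding zonal_conv_def using cheb_convolution[OF that(2) x, of "d + 2 * i" l] l[OF that(1)] by simp
  then have "(\<integral>y. ?h y * zonal_conv (d + 2 * i) ?h y \<partial>\<sigma>) = 0" if "i \<le> n" for i
    using that by (subst Bochner_Integration.integral_cong[where g = "\<lambda>_. 0"]) auto
  then have "(\<integral>y. u y * w y * ?h y \<partial>\<sigma>)\<^sup>2 \<le> 0"
    using product_duality_zonal[OF u w, of ?h] by (simp add: continuous_intros)
  then show ?thesis by (simp add: zonal_conv_def mult.commute)
qed

text \<open>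
  Both sides have the same zonal moments at \<open>x\<close>, outside the range because those of the product vanish.
\<close>

lemma product_zonal_expansion:
  assumes u: "sphere_harmonic (d + n) u" and w: "sphere_harmonic n w" and x: "x \<in> \<S>"
  shows "u x * w x = (\<Sum>i\<le>n. (real (d + 2 * i) + 1) * zonal_conv (d + 2 * i) (\<lambda>y. u y * w y) x)"
proof -
  define F where "F y = u y * w y" for y
  define S where "S y = (\<Sum>i\<le>n. (real (d + 2 * i) + 1) * zonal_conv (d + 2 * i) F y)" for y
  have cF: "continuous_on \<S> F"
    unfolding F_def by (intro continuous_intros sphere_harmonic_continuous[OF u] sphere_harmonic_continuous[OF w])
  have cS: "continuous_on \<S> S"
    unfolding S_def by (intro continuous_intros zonal_conv_continuous cF)
  have "F x - S x = 0"
  proof (rule cheb_moments_unique[OF _ x, of "\<lambda>y. F y - S y"])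
    show "continuous_on \<S> (\<lambda>y. F y - S y)" by (intro continuous_intros cF cS)
    fix l
    have "(\<integral>y. poly (cheb l) (x \<bullet> y) * S y \<partial>\<sigma>)
        = (\<integral>y. (\<Sum>i\<le>n. (real (d + 2 * i) + 1) * (poly (cheb l) (x \<bullet> y) * zonal_conv (d + 2 * i) F y)) \<partial>\<sigma>)"
      by (simp add: S_def sum_distrib_left mult.left_commute)
    also have "\<dots> = (\<Sum>i\<le>n. (real (d + 2 * i) + 1) * zonal_conv l (zonal_conv (d + 2 * i) F) x)"
    proof -
      have "integrable \<sigma> (\<lambda>y. poly (cheb l) (x \<bullet> y) * zonal_conv j F y)" for j
        by (intro integrable_continuous_sphere continuous_intros zonal_conv_continuous cF)
      then show ?thesis unfolding zonal_conv_def[of l] by (subst Bochner_Integration.integral_sum) auto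
    qed
    also have "\<dots> = (\<Sum>i\<le>n. if l = d + 2 * i then zonal_conv l F x else 0)"
      by (intro sum.cong refl) (auto simp: zonal_conv_zonal_conv[OF cF x])
    also have "\<dots> = zonal_conv l F x"
    proof (cases "\<exists>k\<le>n. l = d + 2 * k")
      case True
      then obtain k where k: "k \<le> n" "l = d + 2 * k" by blast
      then have "(\<Sum>i\<le>n. if l = d + 2 * i then zonal_conv l F x else 0) = (\<Sum>i\<le>n. if k = i then zonal_conv l F x else 0)"
        by (intro sum.cong) auto
      then show ?thesis using k(1) by simp
    next
      case False
      then show ?thesis using product_frequency_range[OF u w _ x, of l] unfolding F_def by (auto intro!: sum.neutral)
    qed
    finally have "(\<integral>y. poly (cheb l) (x \<bullet> y) * S y \<partial>\<sigma>) = (\<integral>y. poly (cheb l) (x \<bullet> y) * F y \<partial>\<sigma>)"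
      by (simp add: zonal_conv_def)
    moreover have "integrable \<sigma> (\<lambda>y. poly (cheb l) (x \<bullet> y) * F y)" "integrable \<sigma> (\<lambda>y. poly (cheb l) (x \<bullet> y) * S y)"
      by (intro integrable_continuous_sphere continuous_intros cF cS)+
    ultimately show "(\<integral>y. poly (cheb l) (x \<bullet> y) * (F y - S y) \<partial>\<sigma>) = 0"
      by (simp add: right_diff_distrib)
  qed
  then show ?thesis by (simp add: F_def[abs_def] S_def)
qed

text \<open>
  Test the duality bound with \<open>h\<close>, minus the Laplacian of the product. Both its double integral and the
  Dirichlet integral \<open>D\<close> are combinations of the nonnegative numbers \<open>T j\<close>, with coefficients \<open>j (j + 2)\<close> and
  \<open>j + 1\<close>, so the first is at most \<open>(d + 2 n + 1) D\<close>; cancelling one \<open>D\<close> from \<open>D\<^sup>2\<close> leaves the claim.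
\<close>

lemma product_dirichlet_bound:
  assumes u: "sphere_harmonic (d + n) u" and w: "sphere_harmonic n w"
    and lap: "has_laplacian (\<lambda>p. u p * w p) (\<lambda>p. - h p)"
  shows "(\<integral>x. u x * w x * h x \<partial>\<sigma>) \<le> (real (d + n) + 1) * (real n + 1) * (real (d + 2 * n) + 1)
     * (\<integral>x. (u x)\<^sup>2 \<partial>\<sigma>) * (\<integral>x. (w x)\<^sup>2 \<partial>\<sigma>)"
proof -
  define F where "F y = u y * w y" for y
  have lapF: "has_laplacian F (\<lambda>p. - h p)" using lap by (simp add: F_def[abs_def])
  have cF: "continuous_on \<S> F" and "continuous_on \<S> (\<lambda>p. - h p)"
    using has_laplacian_continuous[OF lapF] by auto
  then have ch: "continuous_on \<S> h" using continuous_on_minus[of \<S> "\<lambda>p. - h p"] by simp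
  \<comment> \<open>\<open>T j\<close> is \<open>j (j + 2) / (j + 1)\<close> times the squared norm of the degree \<open>j\<close> component of \<open>F\<close>.\<close>
  define T where "T j = (\<integral>x. h x * zonal_conv j F x \<partial>\<sigma>)" for j
  define D where "D = (\<integral>x. F x * h x \<partial>\<sigma>)"
  have conv_h: "zonal_conv j h x = real j * (real j + 2) * zonal_conv j F x" if "x \<in> \<S>" for j x
    unfolding zonal_conv_def by (rule cheb_integral_laplacian[OF that lapF])
  have T_F: "T j = real j * (real j + 2) * (\<integral>x. F x * zonal_conv j F x \<partial>\<sigma>)" for j
  proof -
    have "T j = (\<integral>x. F x * zonal_conv j h x \<partial>\<sigma>)"
      unfolding T_def by (rule zonal_conv_self_adjoint[OF cF ch])
    also have "\<dots> = (\<integral>x. real j * (real j + 2) * (F x * zonal_conv j F x) \<partial>\<sigma>)"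
      by (intro Bochner_Integration.integral_cong refl) (simp add: conv_h)
    finally show ?thesis by simp
  qed
  have T0: "0 \<le> T j" for j unfolding T_F using zonal_conv_nonneg[OF cF, of j] by simp
  have D_sum: "D = (\<Sum>i\<le>n. (real (d + 2 * i) + 1) * T (d + 2 * i))"
  proof -
    have "D = (\<integral>x. (\<Sum>i\<le>n. (real (d + 2 * i) + 1) * (h x * zonal_conv (d + 2 * i) F x)) \<partial>\<sigma>)"
      unfolding D_def
    proof (intro Bochner_Integration.integral_cong refl)
      fix x assume "x \<in> space \<sigma>"
      then have "F x = (\<Sum>i\<le>n. (real (d + 2 * i) + 1) * zonal_conv (d + 2 * i) F x)"
        using product_zonal_expansion[OF u w, of x] by (simp add: F_def[abs_def])
      then have "F x * h x = (\<Sum>i\<le>n. (real (d + 2 * i) + 1) * zonal_conv (d + 2 * i) F x) * h x" by simp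
      then show "F x * h x = (\<Sum>i\<le>n. (real (d + 2 * i) + 1) * (h x * zonal_conv (d + 2 * i) F x))"
        by (simp only: sum_distrib_right sum_distrib_left mult_ac)
    qed
    moreover have "integrable \<sigma> (\<lambda>x. h x * zonal_conv j F x)" for j
      by (intro integrable_continuous_sphere continuous_intros ch zonal_conv_continuous cF)
    ultimately show ?thesis by (simp add: T_def)
  qed
  have "(\<Sum>i\<le>n. \<integral>x. h x * zonal_conv (d + 2 * i) h x \<partial>\<sigma>)
      = (\<Sum>i\<le>n. real (d + 2 * i) * (real (d + 2 * i) + 2) * T (d + 2 * i))"
  proof (intro sum.cong refl)
    fix i
    have "(\<integral>x. h x * zonal_conv j h x \<partial>\<sigma>) = (\<integral>x. real j * (real j + 2) * (h x * zonal_conv j F x) \<partial>\<sigma>)" for j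
      by (intro Bochner_Integration.integral_cong refl) (simp add: conv_h)
    then show "(\<integral>x. h x * zonal_conv (d + 2 * i) h x \<partial>\<sigma>) = real (d + 2 * i) * (real (d + 2 * i) + 2) * T (d + 2 * i)"
      by (simp only: T_def integral_mult_right_zero)
  qed
  also have "\<dots> \<le> (\<Sum>i\<le>n. (real (d + 2 * n) + 1) * ((real (d + 2 * i) + 1) * T (d + 2 * i)))"
  proof (rule sum_mono)
    fix i assume "i \<in> {..n}"
    then have "real (d + 2 * i) + 1 \<le> real (d + 2 * n) + 1" by simp
    then have "(real (d + 2 * i) + 1) * (real (d + 2 * i) + 1) \<le> (real (d + 2 * n) + 1) * (real (d + 2 * i) + 1)"
      by (rule mult_right_mono) simp
    moreover have "real (d + 2 * i) * (real (d + 2 * i) + 2) \<le> (real (d + 2 * i) + 1) * (real (d + 2 * i) + 1)"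
      by (simp add: algebra_simps)
    ultimately have "real (d + 2 * i) * (real (d + 2 * i) + 2) \<le> (real (d + 2 * n) + 1) * (real (d + 2 * i) + 1)"
      by linarith
    then show "real (d + 2 * i) * (real (d + 2 * i) + 2) * T (d + 2 * i)
        \<le> (real (d + 2 * n) + 1) * ((real (d + 2 * i) + 1) * T (d + 2 * i))"
      unfolding mult.assoc[symmetric] using T0 by (rule mult_right_mono)
  qed
  also have "\<dots> = (real (d + 2 * n) + 1) * D" unfolding D_sum sum_distrib_left ..
  finally have sum_le: "(\<Sum>i\<le>n. \<integral>x. h x * zonal_conv (d + 2 * i) h x \<partial>\<sigma>) \<le> (real (d + 2 * n) + 1) * D" .
  define A where "A = (real (d + n) + 1) * (real n + 1) * (\<integral>x. (u x)\<^sup>2 \<partial>\<sigma>) * (\<integral>x. (w x)\<^sup>2 \<partial>\<sigma>)"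
  have A0: "A \<ge> 0" by (simp add: A_def)
  have "D\<^sup>2 \<le> A * (\<Sum>i\<le>n. \<integral>x. h x * zonal_conv (d + 2 * i) h x \<partial>\<sigma>)"
    using product_duality_zonal[OF u w ch] by (simp add: D_def F_def A_def)
  also have "\<dots> \<le> A * ((real (d + 2 * n) + 1) * D)" by (rule mult_left_mono[OF sum_le A0])
  finally have "D * D \<le> (A * (real (d + 2 * n) + 1)) * D" by (simp add: power2_eq_square mult.assoc)
  moreover have "0 \<le> A * (real (d + 2 * n) + 1)" using A0 by simp
  moreover have "0 \<le> D" unfolding D_sum using T0 by (intro sum_nonneg mult_nonneg_nonneg) auto
  ultimately have "D \<le> A * (real (d + 2 * n) + 1)"
    using mult_right_le_imp_le[of D D "A * (real (d + 2 * n) + 1)"] by (cases "D = 0") auto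
  then show ?thesis by (simp add: D_def F_def A_def mult_ac)
qed

text \<open>
  The two bounds for the Dirichlet integral are combined through \<open>(m + 1) (m + n + 1) \<le> 2 m (m + 2)\<close>, valid
  for \<open>1 \<le> m\<close> and \<open>n \<le> m\<close>. In degree zero the pointwise bound suffices.
\<close>

lemma harmonic_product_L2_bound:
  assumes u: "sphere_harmonic m u" and w: "sphere_harmonic n w" and "n \<le> m"
  shows "(\<integral>x. (u x * w x)\<^sup>2 \<partial>\<sigma>) \<le> 2 * (real n + 1) * (\<integral>x. (u x)\<^sup>2 \<partial>\<sigma>) * (\<integral>x. (w x)\<^sup>2 \<partial>\<sigma>)"
proof (cases "m = 0")
  case True
  then have n: "n = 0" using \<open>n \<le> m\<close> by simp
  note cont = sphere_harmonic_continuous[OF u] sphere_harmonic_continuous[OF w]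
  have "(\<integral>x. (u x * w x)\<^sup>2 \<partial>\<sigma>) \<le> (\<integral>x. (u x)\<^sup>2 * (\<integral>y. (w y)\<^sup>2 \<partial>\<sigma>) \<partial>\<sigma>)"
  proof (rule integral_mono)
    show "(u x * w x)\<^sup>2 \<le> (u x)\<^sup>2 * (\<integral>y. (w y)\<^sup>2 \<partial>\<sigma>)" if "x \<in> space \<sigma>" for x
      using sphere_harmonic_sup_bound[OF w, of x] that n by (simp add: power_mult_distrib mult_left_mono)
  qed (intro integrable_continuous_sphere continuous_intros cont)+
  also have "\<dots> = (\<integral>x. (u x)\<^sup>2 \<partial>\<sigma>) * (\<integral>x. (w x)\<^sup>2 \<partial>\<sigma>)" by simp
  also have "\<dots> \<le> 2 * ((\<integral>x. (u x)\<^sup>2 \<partial>\<sigma>) * (\<integral>x. (w x)\<^sup>2 \<partial>\<sigma>))" by simp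
  finally show ?thesis using n by simp
next
  case False
  obtain d where m: "m = d + n" using \<open>n \<le> m\<close> le_Suc_ex by (metis add.commute)
  obtain h where lap: "has_laplacian (\<lambda>p. u p * w p) (\<lambda>p. - h p)"
    and energy: "real m * (real m + 2) * (\<integral>p. (u p * w p)\<^sup>2 \<partial>\<sigma>) \<le> (\<integral>p. u p * w p * h p \<partial>\<sigma>)"
    using product_energy[OF u[unfolded sphere_harmonic_def] w[unfolded sphere_harmonic_def]] by blast
  define N where "N = (\<integral>x. (u x)\<^sup>2 \<partial>\<sigma>) * (\<integral>x. (w x)\<^sup>2 \<partial>\<sigma>)"
  have N0: "0 \<le> N" by (simp add: N_def)
  let ?Q = "real m * (real m + 2)"
  have Q: "?Q > 0" using False by simp
  have "?Q * (\<integral>p. (u p * w p)\<^sup>2 \<partial>\<sigma>) \<le> (real m + 1) * (real n + 1) * (real (d + 2 * n) + 1) * N"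
    using energy product_dirichlet_bound[OF u[unfolded m] w lap] by (simp add: N_def m mult.assoc)
  also have "\<dots> = ((real m + 1) * (real (d + 2 * n) + 1)) * ((real n + 1) * N)" by simp
  also have "\<dots> \<le> (?Q * 2) * ((real n + 1) * N)"
  proof (rule mult_right_mono)
    have "(real m + 1) * (real (d + 2 * n) + 1) \<le> (real m + 1) * (2 * real m + 1)"
      by (rule mult_left_mono) (simp_all add: m)
    also have "\<dots> \<le> ?Q * 2" using False by (simp add: algebra_simps)
    finally show "(real m + 1) * (real (d + 2 * n) + 1) \<le> ?Q * 2" .
  qed (use N0 in simp)
  finally have "?Q * (\<integral>p. (u p * w p)\<^sup>2 \<partial>\<sigma>) \<le> ?Q * (2 * ((real n + 1) * N))" by (simp only: mult.assoc)
  then have "(\<integral>p. (u p * w p)\<^sup>2 \<partial>\<sigma>) \<le> 2 * ((real n + 1) * N)"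
    using Q by (simp only: mult_le_cancel_left_pos)
  then show ?thesis by (simp only: N_def mult.assoc)
qed

section \<open>Complex eigenfunctions and several factors\<close>

definition complex_harmonic :: "nat \<Rightarrow> (real^4 \<Rightarrow> complex) \<Rightarrow> bool" where
  "complex_harmonic m f \<longleftrightarrow> sphere_harmonic m (\<lambda>x. Re (f x)) \<and> sphere_harmonic m (\<lambda>x. Im (f x))"

text \<open>
  The eigenvalue is real and the Laplacian acts on real and imaginary parts separately.
\<close>

lemma sphere_eigenfunction_imp_complex_harmonic:
  assumes f: "sphere_eigenfunction (- (real m * (real m + 2))) f"
  shows "complex_harmonic m f"
proof -
  have lap: "sphere_laplacian f p = of_real (- (real m * (real m + 2))) * f p" if "p \<in> \<S>" for p
    using f that by (simp add: sphere_eigenfunction_def)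
  have transfer: "has_laplacian u (\<lambda>p. c * u p)" if "sphere_C2_real u" "\<And>p. p \<in> \<S> \<Longrightarrow> sphere_laplacian_real u p = c * u p" for u c
    using has_laplacian_sphere_laplacian_real[OF that(1)] that(2) unfolding has_laplacian_def by simp
  have "sphere_laplacian_real (\<lambda>x. Re (f x)) p = - (real m * (real m + 2)) * Re (f p)"
       "sphere_laplacian_real (\<lambda>x. Im (f x)) p = - (real m * (real m + 2)) * Im (f p)" if "p \<in> \<S>" for p
    using arg_cong[OF lap[OF that], of Re] arg_cong[OF lap[OF that], of Im] unfolding sphere_laplacian_def by simp_all
  moreover have "sphere_C2_real (\<lambda>x. Re (f x))" "sphere_C2_real (\<lambda>x. Im (f x))"
    using f by (auto simp: sphere_eigenfunction_def sphere_C2_def)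
  ultimately show ?thesis
    unfolding complex_harmonic_def sphere_harmonic_def by (intro conjI transfer)
qed

lemma sphere_L2_norm_square: "(sphere_L2_norm f)\<^sup>2 = (\<integral>x. (cmod (f x))\<^sup>2 \<partial>\<sigma>)" for f :: "real^4 \<Rightarrow> complex"
  by (simp add: sphere_L2_norm_def)

lemma sphere_L2_norm_nonneg: "0 \<le> sphere_L2_norm f" for f :: "real^4 \<Rightarrow> complex"
  by (simp add: sphere_L2_norm_def)

lemma sphere_L2_norm_square_Re_Im:
  assumes f: "complex_harmonic m f"
  shows "(sphere_L2_norm f)\<^sup>2 = (\<integral>x. (Re (f x))\<^sup>2 \<partial>\<sigma>) + (\<integral>x. (Im (f x))\<^sup>2 \<partial>\<sigma>)"
proof -
  have c: "continuous_on \<S> (\<lambda>x. Re (f x))" "continuous_on \<S> (\<lambda>x. Im (f x))"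
    using f sphere_harmonic_continuous unfolding complex_harmonic_def by auto
  show ?thesis
    unfolding sphere_L2_norm_square cmod_power2
    by (intro Bochner_Integration.integral_add integrable_continuous_sphere continuous_intros c)
qed

lemma complex_harmonic_sup_bound:
  assumes f: "complex_harmonic m f" and x: "x \<in> \<S>"
  shows "cmod (f x) \<le> (real m + 1) * sphere_L2_norm f"
proof (rule power2_le_imp_le)
  have "(Re (f x))\<^sup>2 \<le> (real m + 1)\<^sup>2 * (\<integral>y. (Re (f y))\<^sup>2 \<partial>\<sigma>)" "(Im (f x))\<^sup>2 \<le> (real m + 1)\<^sup>2 * (\<integral>y. (Im (f y))\<^sup>2 \<partial>\<sigma>)"
    using f sphere_harmonic_sup_bound[OF _ x] unfolding complex_harmonic_def by blast+
  then show "(cmod (f x))\<^sup>2 \<le> ((real m + 1) * sphere_L2_norm f)\<^sup>2"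
    unfolding power_mult_distrib sphere_L2_norm_square_Re_Im[OF f] cmod_power2 by (simp add: distrib_left)
qed (simp add: sphere_L2_norm_nonneg)

lemma complex_harmonic_product_L2_bound:
  assumes f: "complex_harmonic m f" and g: "complex_harmonic n g" and "n \<le> m"
  shows "(sphere_L2_norm (\<lambda>x. f x * g x))\<^sup>2 \<le> 2 * (real n + 1) * (sphere_L2_norm f)\<^sup>2 * (sphere_L2_norm g)\<^sup>2"
proof -
  define a b c d where "a x = Re (f x)" and "b x = Im (f x)" and "c x = Re (g x)" and "d x = Im (g x)" for x
  have ab: "sphere_harmonic m a" "sphere_harmonic m b" and cd: "sphere_harmonic n c" "sphere_harmonic n d"
    using f g unfolding complex_harmonic_def a_def b_def c_def d_def by auto
  note cont = ab[THEN sphere_harmonic_continuous] cd[THEN sphere_harmonic_continuous]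
  have int: "integrable \<sigma> (\<lambda>x. (s x * t x)\<^sup>2)" if "continuous_on \<S> s" "continuous_on \<S> t" for s t :: "real^4 \<Rightarrow> real"
    by (intro integrable_continuous_sphere continuous_intros that)
  have "(cmod (f x * g x))\<^sup>2 = (a x * c x)\<^sup>2 + (a x * d x)\<^sup>2 + (b x * c x)\<^sup>2 + (b x * d x)\<^sup>2" for x
    by (simp only: norm_mult power_mult_distrib cmod_power2 a_def b_def c_def d_def) (simp add: algebra_simps)
  then have "(sphere_L2_norm (\<lambda>x. f x * g x))\<^sup>2
      = (\<integral>x. (a x * c x)\<^sup>2 \<partial>\<sigma>) + (\<integral>x. (a x * d x)\<^sup>2 \<partial>\<sigma>) + (\<integral>x. (b x * c x)\<^sup>2 \<partial>\<sigma>) + (\<integral>x. (b x * d x)\<^sup>2 \<partial>\<sigma>)"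
    by (simp add: sphere_L2_norm_square int cont)
  also have "\<dots> \<le> 2 * (real n + 1) * (\<integral>x. (a x)\<^sup>2 \<partial>\<sigma>) * (\<integral>x. (c x)\<^sup>2 \<partial>\<sigma>)
      + 2 * (real n + 1) * (\<integral>x. (a x)\<^sup>2 \<partial>\<sigma>) * (\<integral>x. (d x)\<^sup>2 \<partial>\<sigma>)
      + 2 * (real n + 1) * (\<integral>x. (b x)\<^sup>2 \<partial>\<sigma>) * (\<integral>x. (c x)\<^sup>2 \<partial>\<sigma>)
      + 2 * (real n + 1) * (\<integral>x. (b x)\<^sup>2 \<partial>\<sigma>) * (\<integral>x. (d x)\<^sup>2 \<partial>\<sigma>)"
    by (intro add_mono harmonic_product_L2_bound[where m = m] ab cd \<open>n \<le> m\<close>)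
  also have "\<dots> = 2 * (real n + 1) * (sphere_L2_norm f)\<^sup>2 * (sphere_L2_norm g)\<^sup>2"
    unfolding sphere_L2_norm_square_Re_Im[OF f] sphere_L2_norm_square_Re_Im[OF g] a_def b_def c_def d_def
    by (simp only: distrib_left distrib_right)
  finally show ?thesis .
qed

lemma complex_harmonic_continuous:
  assumes "complex_harmonic m f"
  shows "continuous_on \<S> f"
proof -
  have "continuous_on \<S> (\<lambda>x. Complex (Re (f x)) (Im (f x)))"
    using assms sphere_harmonic_continuous unfolding complex_harmonic_def
    by (intro continuous_on_Complex) auto
  then show ?thesis by simp
qed

theorem corollary4p1:
  shows "\<exists>C::real. C > 0 \<and>
    (\<forall>(k::nat) (m :: nat \<Rightarrow> nat) (f :: nat \<Rightarrow> real ^ 4 \<Rightarrow> complex).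
       k \<ge> 2 \<longrightarrow>
       antimono_on {1..k} m \<longrightarrow>
       (\<forall>i\<in>{1..k}. sphere_eigenfunction (- (real (m i) * (real (m i) + 2))) (f i)) \<longrightarrow>
       sphere_L2_norm (\<lambda>x. \<Prod>i=1..k. f i x)
         \<le> C * ((real (m 2) + 1) powr (1/2) * (\<Prod>i=3..k. (real (m i) + 1)))
             * (\<Prod>i=1..k. sphere_L2_norm (f i)))"
proof (intro exI[of _ "sqrt 2"] conjI allI impI)
  fix k :: nat and m :: "nat \<Rightarrow> nat" and f :: "nat \<Rightarrow> real^4 \<Rightarrow> complex"
  assume k: "k \<ge> 2" and mono: "antimono_on {1..k} m"
    and eig: "\<forall>i\<in>{1..k}. sphere_eigenfunction (- (real (m i) * (real (m i) + 2))) (f i)"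
  have harm: "complex_harmonic (m i) (f i)" if "i \<in> {1..k}" for i
    using eig that sphere_eigenfunction_imp_complex_harmonic by blast
  have m21: "m 2 \<le> m 1" using mono k by (auto simp: monotone_on_def)
  have split: "(\<Prod>i=1..k. g i) = g 1 * g 2 * (\<Prod>i=3..k. g i)" for g :: "nat \<Rightarrow> 'b::comm_monoid_mult"
  proof -
    have "{1..k} = insert 1 (insert 2 {3..k})" using k by auto
    then show ?thesis by (simp add: mult.assoc)
  qed
  define R where "R = (\<Prod>i=3..k. (real (m i) + 1) * sphere_L2_norm (f i))"
  have R0: "R \<ge> 0" unfolding R_def by (intro prod_nonneg) (simp add: sphere_L2_norm_nonneg)
  have tail: "cmod (\<Prod>i=3..k. f i x) \<le> R" if "x \<in> \<S>" for x
    unfolding prod_norm[symmetric] R_def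
    by (intro prod_mono) (use complex_harmonic_sup_bound[OF harm that] in auto)
  have cont: "continuous_on \<S> (f i)" if "i \<in> {1..k}" for i
    using complex_harmonic_continuous[OF harm[OF that]] .
  have c12: "continuous_on \<S> (f 1)" "continuous_on \<S> (f 2)" using cont k by auto
  have call: "continuous_on \<S> (\<lambda>x. \<Prod>i=1..k. f i x)"
    by (intro continuous_on_prod cont)
  have "(sphere_L2_norm (\<lambda>x. \<Prod>i=1..k. f i x))\<^sup>2 \<le> (\<integral>x. R\<^sup>2 * (cmod (f 1 x * f 2 x))\<^sup>2 \<partial>\<sigma>)"
    unfolding sphere_L2_norm_square
  proof (rule integral_mono)
    show "integrable \<sigma> (\<lambda>x. (cmod (\<Prod>i=1..k. f i x))\<^sup>2)"
      by (intro integrable_continuous_sphere continuous_intros call)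
    show "integrable \<sigma> (\<lambda>x. R\<^sup>2 * (cmod (f 1 x * f 2 x))\<^sup>2)"
      by (intro integrable_continuous_sphere continuous_intros c12)
    show "(cmod (\<Prod>i=1..k. f i x))\<^sup>2 \<le> R\<^sup>2 * (cmod (f 1 x * f 2 x))\<^sup>2" if "x \<in> space \<sigma>" for x
    proof -
      have "cmod (\<Prod>i=1..k. f i x) \<le> R * cmod (f 1 x * f 2 x)"
        unfolding split norm_mult[of "f 1 x * f 2 x"] 
        using mult_left_mono[OF tail[of x], of "cmod (f 1 x * f 2 x)"] that by (simp add: mult.commute)
      from power_mono[OF this norm_ge_zero, of 2] show ?thesis by (simp only: power_mult_distrib)
    qed
  qed
  also have "\<dots> = R\<^sup>2 * (sphere_L2_norm (\<lambda>x. f 1 x * f 2 x))\<^sup>2" by (simp add: sphere_L2_norm_square)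
  also have "\<dots> \<le> R\<^sup>2 * (2 * (real (m 2) + 1) * (sphere_L2_norm (f 1))\<^sup>2 * (sphere_L2_norm (f 2))\<^sup>2)"
    using k by (intro mult_left_mono complex_harmonic_product_L2_bound[where m = "m 1" and n = "m 2"] harm m21) auto
  also have "\<dots> = (sqrt 2 * sqrt (real (m 2) + 1) * R * (sphere_L2_norm (f 1) * sphere_L2_norm (f 2)))\<^sup>2"
    by (simp add: power_mult_distrib)
  finally have "sphere_L2_norm (\<lambda>x. \<Prod>i=1..k. f i x)
      \<le> sqrt 2 * sqrt (real (m 2) + 1) * R * (sphere_L2_norm (f 1) * sphere_L2_norm (f 2))"
    by (rule power2_le_imp_le) (use R0 in \<open>simp add: sphere_L2_norm_nonneg\<close>)
  also have "\<dots> = sqrt 2 * ((real (m 2) + 1) powr (1/2) * (\<Prod>i=3..k. (real (m i) + 1)))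
             * (\<Prod>i=1..k. sphere_L2_norm (f i))"
    unfolding split R_def prod.distrib by (simp add: powr_half_sqrt)
  finally show "sphere_L2_norm (\<lambda>x. \<Prod>i=1..k. f i x)
      \<le> sqrt 2 * ((real (m 2) + 1) powr (1/2) * (\<Prod>i=3..k. (real (m i) + 1)))
             * (\<Prod>i=1..k. sphere_L2_norm (f i))" .
qed simp

end
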